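(* Let $P$ be an $n$-dimensional lattice polytope in $M\otimes_{\mathbb Z}\mathbb R$, where $M$ is a lattice of rank $n$, and let $X_P$ be the associated projective toric variety with orbit map $\pi\colon X_P\to P$. Let $k\ge 0$ be an integer. Suppose there exists a conic sequence $\{\mathcal P_i\}_{1\le i\le \ell}$ of $P$, with associated polytopes $C_2,\dots,C_\ell$ and associated spaces $Y_i=\pi^{-1}(C_i)$, such that $\widetilde H^{2k}(Y_i;\mathbb Q)=0$ for all $i=2,\dots,\ell$. Then $H^{2k+1}(X_P;\mathbb Q)=0$.
   Context: **Conic sequences.** Let $P$ be a convex polytope with $\ell$ vertices and let $\mathcal P$ be the polytopal complex of all faces of $P$ (including $\emptyset$ and $P$), ordered by inclusion. Set $\mathcal P_\ell=\mathcal P$. Given a subcomplex $\mathcal P_i$, choose, if possible, a vertex $v_i$ of $\mathcal P_i$ (a *cone vertex* ) such that the subposet $\{F\in\mathcal P_i : v_i\subseteq F\}$ has a unique maximal element $E_i$, and put $\mathcal P_{i-1}=\mathcal P_i\setminus [v_i,E_i]$, where $[v_i,E_i]=\{F\in\mathcal P_i : v_i\subseteq F\subseteq E_i\}$. The resulting sequence $\{\mathcal P_i\}_{1\le i\le \ell}$ is a *conic sequence* of $P$ if it ends with $\mathcal P_1=\{\emptyset,v_1\}$ for some vertex $v_1$ of $P$. Write $P_i=\bigcup_{F\in\mathcal P_i}F$. For $2\le i\le\ell$, $C_i$ denotes the intersection of $E_i$ with an affine hyperplane separating $v_i$ from $P_{i-1}\cap E_i$ (the vertex figure of $E_i$ at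 $v_i$); the hyperplane is taken so that $C_i$ is a rational polytope. **Topological model of $X_P$.** Let $M$ be the character lattice of the compact torus $T^n$ and $N$ the dual lattice of one-parameter subgroups. For a facet $F$ of $P$ let $\lambda(F)\in N$ be its primitive outward normal vector. For a face $E$ of $P$ let $N_E\subseteq N$ be the submodule generated by the $\lambda(F)$ for all facets $F$ of $P$ with $E\subseteq F$, and let $T_E=(N_E\otimes\mathbb R)/((N_E\otimes\mathbb R)\cap N)\subseteq T^n$. The projective toric variety associated with $P$ is, as a topological space, $X_P=(P\times T^n)/\!\sim$, where $(p,t)\sim(q,s)$ iff $p=q$ and $t^{-1}s\in T_E$, $E$ being the face containing $p$ in its relative interior. The orbit map $\pi\colon X_P\to P$ is induced by the projection to the first factor. *)

theory Defs
  imports "HOL-Analysis.Analysis" "HOL-Homology.Homology"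
begin

subsection \<open>Quotient spaces and additive groups\<close>

definition quotient_topology :: "'a topology \<Rightarrow> ('a \<Rightarrow> 'b) \<Rightarrow> 'b topology" where
  "quotient_topology X f =
     topology (\<lambda>U. U \<subseteq> f ` topspace X \<and> openin X {x \<in> topspace X. f x \<in> U})"

lemma openin_quotient_topology:
  "openin (quotient_topology X f) U \<longleftrightarrow>
     U \<subseteq> f ` topspace X \<and> openin X {x \<in> topspace X. f x \<in> U}"
proof -
  have "istopology (\<lambda>U. U \<subseteq> f ` topspace X \<and> openin X {x \<in> topspace X. f x \<in> U})"
    unfolding istopology_def
  proof (intro conjI allI impI)
    fix S T
    assume "S \<subseteq> f ` topspace X \<and> openin X {x \<in> topspace X. f x \<in> S}"
      "T \<subseteq> f ` topspace X \<and> openin X {x \<in> topspace X. f x \<in> T}"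
    moreover have "{x \<in> topspace X. f x \<in> S \<inter> T} =
      {x \<in> topspace X. f x \<in> S} \<inter> {x \<in> topspace X. f x \<in> T}" by auto
    ultimately show "S \<inter> T \<subseteq> f ` topspace X" "openin X {x \<in> topspace X. f x \<in> S \<inter> T}"
      by auto
  next
    fix K
    assume K: "\<forall>S\<in>K. S \<subseteq> f ` topspace X \<and> openin X {x \<in> topspace X. f x \<in> S}"
    have "{x \<in> topspace X. f x \<in> \<Union>K} = (\<Union>S\<in>K. {x \<in> topspace X. f x \<in> S})" by auto
    with K show "\<Union>K \<subseteq> f ` topspace X" "openin X {x \<in> topspace X. f x \<in> \<Union>K}"
      by auto
  qed
  then show ?thesis
    by (simp add: quotient_topology_def topology_inverse')
qed

lemma quotient_map_quotient_topology: "quotient_map X (quotient_topology X f) f"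
proof -
  have "openin (quotient_topology X f) (f ` topspace X)"
    by (auto simp: openin_quotient_topology intro: back_subst[of "openin X", OF openin_topspace])
  then have "topspace (quotient_topology X f) = f ` topspace X"
    by (meson openin_quotient_topology openin_subset openin_topspace subset_antisym)
  then show ?thesis
    by (auto simp: quotient_map_def openin_quotient_topology)
qed

definition additive_group :: "'a::ab_group_add set \<Rightarrow> 'a monoid" where
  "additive_group A = \<lparr>carrier = A, mult = (+), one = 0\<rparr>"

subsection \<open>Singular cohomology with rational coefficients\<close>

text \<open>The cochain group is $\mathrm{Hom}(C_p(X),\mathbf{Q})$. A homomorphism is made unique as a
  HOL function by requiring it to be \<^term>\<open>undefined\<close> outside the singular chains of \<open>X\<close>.\<close>

definition cochain_group :: "nat \<Rightarrow> 'a topology \<Rightarrow> ('a chain \<Rightarrow> rat) monoid" where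
  "cochain_group p X =
     \<lparr>carrier = hom (chain_group p X) (additive_group UNIV) \<inter> extensional (singular_chain_set p X),
      mult = (\<lambda>\<phi> \<psi>. \<lambda>c\<in>singular_chain_set p X. \<phi> c + \<psi> c),
      one = (\<lambda>c\<in>singular_chain_set p X. 0)\<rparr>"

definition coboundary :: "nat \<Rightarrow> 'a topology \<Rightarrow> ('a chain \<Rightarrow> rat) \<Rightarrow> 'a chain \<Rightarrow> rat" where
  "coboundary p X \<phi> = (\<lambda>c\<in>singular_chain_set (Suc p) X. \<phi> (chain_boundary (Suc p) c))"

definition cocycles :: "nat \<Rightarrow> 'a topology \<Rightarrow> ('a chain \<Rightarrow> rat) set" where
  "cocycles p X = kernel (cochain_group p X) (cochain_group (Suc p) X) (coboundary p X)"

definition coboundaries :: "nat \<Rightarrow> 'a topology \<Rightarrow> ('a chain \<Rightarrow> rat) set" where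
  "coboundaries p X =
     (case p of 0 \<Rightarrow> {\<one>\<^bsub>cochain_group 0 X\<^esub>}
      | Suc q \<Rightarrow> coboundary q X ` carrier (cochain_group q X))"

definition cohomology_group :: "nat \<Rightarrow> 'a topology \<Rightarrow> ('a chain \<Rightarrow> rat) set monoid" where
  "cohomology_group p X = (cochain_group p X)\<lparr>carrier := cocycles p X\<rparr> Mod coboundaries p X"

text \<open>Reduced cohomology is the cohomology of the cochain complex augmented in degree $-1$
  by $\mathrm{Hom}(\mathbf{Z},\mathbf{Q})$.\<close>

definition augmentation :: "'a chain \<Rightarrow> int" where
  "augmentation c = (\<Sum>\<sigma>\<in>Poly_Mapping.keys c. Poly_Mapping.lookup c \<sigma>)"

definition reduced_coboundaries :: "nat \<Rightarrow> 'a topology \<Rightarrow> ('a chain \<Rightarrow> rat) set" where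
  "reduced_coboundaries p X =
     (case p of 0 \<Rightarrow> range (\<lambda>q::rat. \<lambda>c\<in>singular_chain_set 0 X. q * of_int (augmentation c))
      | Suc q \<Rightarrow> coboundary q X ` carrier (cochain_group q X))"

definition reduced_cohomology_group :: "nat \<Rightarrow> 'a topology \<Rightarrow> ('a chain \<Rightarrow> rat) set monoid" where
  "reduced_cohomology_group p X =
     (cochain_group p X)\<lparr>carrier := cocycles p X\<rparr> Mod reduced_coboundaries p X"

subsection \<open>Lattices and lattice polytopes\<close>

definition int_span :: "'a::real_vector set \<Rightarrow> 'a set" where
  "int_span S = {\<Sum>v\<in>A. of_int (c v) *\<^sub>R v |A c. finite A \<and> A \<subseteq> S}"

text \<open>A lattice \<open>M\<close> of rank \<open>n\<close> is realised inside some Euclidean space, whose dimension may be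
  larger than \<open>n\<close> (so that \<open>n = 0\<close> is allowed); then $M\otimes\mathbf{R}$ is \<^term>\<open>span M\<close>.\<close>

definition lattice_of_rank :: "nat \<Rightarrow> 'a::euclidean_space set \<Rightarrow> bool" where
  "lattice_of_rank n M \<longleftrightarrow> (\<exists>B. independent B \<and> card B = n \<and> M = int_span B)"

text \<open>The dual space of $M\otimes\mathbf{R}$ is identified with \<^term>\<open>span M\<close> by the inner product;
  in particular $N\otimes\mathbf{R}$ is \<open>span (dual_lattice M)\<close>.\<close>

definition dual_lattice :: "'a::euclidean_space set \<Rightarrow> 'a set" where
  "dual_lattice M = {y \<in> span M. \<forall>m\<in>M. y \<bullet> m \<in> \<int>}"

definition lattice_polytope :: "'a::euclidean_space set \<Rightarrow> 'a set \<Rightarrow> bool" where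
  "lattice_polytope M P \<longleftrightarrow> (\<exists>S. finite S \<and> S \<subseteq> M \<and> P = convex hull S)"

definition rational_polytope :: "'a::euclidean_space set \<Rightarrow> 'a set \<Rightarrow> bool" where
  "rational_polytope M C \<longleftrightarrow>
     (\<exists>S. finite S \<and> (\<forall>x\<in>S. \<exists>m::nat. m > 0 \<and> of_nat m *\<^sub>R x \<in> M) \<and> C = convex hull S)"

subsection \<open>The topological model of the toric variety\<close>

definition primitive_vector :: "'a::real_vector set \<Rightarrow> 'a \<Rightarrow> bool" where
  "primitive_vector N y \<longleftrightarrow>
     y \<in> N \<and> y \<noteq> 0 \<and> (\<forall>z\<in>N. \<forall>m::nat. y = of_nat m *\<^sub>R z \<longrightarrow> m = 1)"

definition facet_normal :: "'a::euclidean_space set \<Rightarrow> 'a set \<Rightarrow> 'a set \<Rightarrow> 'a" where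
  "facet_normal M P F =
     (THE y. primitive_vector (dual_lattice M) y \<and>
        (\<exists>b. (\<forall>x\<in>P. y \<bullet> x \<le> b) \<and> F = P \<inter> {x. y \<bullet> x = b}))"

definition normal_sublattice :: "'a::euclidean_space set \<Rightarrow> 'a set \<Rightarrow> 'a set \<Rightarrow> 'a set" where
  "normal_sublattice M P E = int_span (facet_normal M P ` {F. F facet_of P \<and> E \<subseteq> F})"

text \<open>The compact torus with lattice of one-parameter subgroups \<open>N\<close>, as $(N\otimes\mathbf{R})/N$.\<close>

definition torus_group :: "'a::euclidean_space set \<Rightarrow> 'a set monoid" where
  "torus_group N = additive_group (span N) Mod N"

definition torus_class :: "'a::euclidean_space set \<Rightarrow> 'a \<Rightarrow> 'a set" where
  "torus_class N v = N #>\<^bsub>additive_group (span N)\<^esub> v"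

definition torus_space :: "'a::euclidean_space set \<Rightarrow> 'a set topology" where
  "torus_space N = quotient_topology (top_of_set (span N)) (torus_class N)"

text \<open>The subtorus $T_E$ is the image of $N_E\otimes\mathbf{R}$ in $(N\otimes\mathbf{R})/N$.\<close>

definition subtorus :: "'a::euclidean_space set \<Rightarrow> 'a set \<Rightarrow> 'a set \<Rightarrow> 'a set set" where
  "subtorus M P E = torus_class (dual_lattice M) ` span (normal_sublattice M P E)"

definition toric_rel ::
  "'a::euclidean_space set \<Rightarrow> 'a set \<Rightarrow> (('a \<times> 'a set) \<times> ('a \<times> 'a set)) set" where
  "toric_rel M P =
     {((p, t), (q, s)).
        p \<in> P \<and> t \<in> carrier (torus_group (dual_lattice M)) \<and>
        q \<in> P \<and> s \<in> carrier (torus_group (dual_lattice M)) \<and> p = q \<and>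
        (\<exists>E. E face_of P \<and> p \<in> rel_interior E \<and>
           inv\<^bsub>torus_group (dual_lattice M)\<^esub> t \<otimes>\<^bsub>torus_group (dual_lattice M)\<^esub> s
             \<in> subtorus M P E)}"

definition toric_variety ::
  "'a::euclidean_space set \<Rightarrow> 'a set \<Rightarrow> ('a \<times> 'a set) set topology" where
  "toric_variety M P =
     quotient_topology (prod_topology (top_of_set P) (torus_space (dual_lattice M)))
       (\<lambda>x. toric_rel M P `` {x})"

text \<open>All elements of a class share their first component.\<close>

definition orbit_map :: "('a \<times> 'a set) set \<Rightarrow> 'a" where
  "orbit_map c = the_elem (fst ` c)"

definition orbit_preimage ::
  "'a::euclidean_space set \<Rightarrow> 'a set \<Rightarrow> 'a set \<Rightarrow> ('a \<times> 'a set) set topology" where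
  "orbit_preimage M P C =
     subtopology (toric_variety M P) {c \<in> topspace (toric_variety M P). orbit_map c \<in> C}"

subsection \<open>Conic sequences\<close>

text \<open>A vertex is a point \<open>w\<close>, and the corresponding face is \<open>{w}\<close>. The sequences are
  only relevant at the following indices: the complexes \<open>K\<close> and the vertices \<open>v\<close> at \<open>1, \<dots>, l\<close>,
  the maximal faces \<open>E\<close> at \<open>2, \<dots>, l\<close>.\<close>

definition conic_sequence ::
  "'a::euclidean_space set \<Rightarrow> nat \<Rightarrow> (nat \<Rightarrow> 'a set set) \<Rightarrow> (nat \<Rightarrow> 'a) \<Rightarrow> (nat \<Rightarrow> 'a set) \<Rightarrow> bool"
  where
  "conic_sequence P l K v E \<longleftrightarrow>
     l = card {w. w extreme_point_of P} \<and>
     K l = {F. F face_of P} \<and>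
     (\<forall>i\<in>{2..l}.
        {v i} \<in> K i \<and>
        {G \<in> K i. v i \<in> G \<and> (\<forall>F\<in>K i. v i \<in> F \<longrightarrow> G \<subseteq> F \<longrightarrow> F = G)} = {E i} \<and>
        K (i - 1) = K i - {F \<in> K i. v i \<in> F \<and> F \<subseteq> E i}) \<and>
     v 1 extreme_point_of P \<and> K 1 = {{}, {v 1}}"

definition conic_vertex_figure ::
  "'a::euclidean_space set \<Rightarrow> (nat \<Rightarrow> 'a set set) \<Rightarrow> (nat \<Rightarrow> 'a) \<Rightarrow> (nat \<Rightarrow> 'a set)
     \<Rightarrow> nat \<Rightarrow> 'a set \<Rightarrow> bool" where
  "conic_vertex_figure M K v E i C \<longleftrightarrow>
     (\<exists>a b. a \<in> span M \<and> a \<noteq> 0 \<and> a \<bullet> v i < b \<and> (\<forall>x \<in> \<Union>(K (i - 1)) \<inter> E i. b < a \<bullet> x) \<and>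
        C = E i \<inter> {x. a \<bullet> x = b}) \<and>
     rational_polytope M C"

end

(*
Since the rationals are an injective abelian group, rational cohomology vanishes in a degree iff the
integral homology (reduced in degree 0) is torsion there, so the argument runs with cycles modulo
torsion. Let X_i be the part of X_P over P_i. Removing the point over the cone vertex v_i from X_i
leaves a space that retracts onto X_{i-1} by radial projection away from v_i; the part of X_i over
the side of the hyperplane containing v_i contracts to the point over v_i; and the two overlap in a
space that retracts onto Y_i. All these homotopies of subsets of P stay inside every face they start
in, so they lift to X_P. Mayer-Vietoris and induction on i, starting from a point, give the claim.
*)
theory Submission
  imports Defs
begin

subsection \<open>Extension of additive maps to the rationals\<close>

text \<open>The analytic data of the lattice matter at the vertices. The part of X_i cut off by the
  hyperplane contracts to the fibre over v_i, and this fibre is one point only because the facet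
  normals at v_i span N tensor R. Those normals are given by a definite description, which denotes
  only if every facet has a primitive normal in N; lattice points on the facet provide it. Lifting
  to X_P constrains the homotopies: a point may move into smaller faces, where larger subtori are
  collapsed, but never out of a face. Moving away from v_i is always allowed, as long as the point
  stays in E_i. Moving towards v_i is allowed only below the hyperplane, where every face that is
  met contains v_i. Parity enters through the contracted piece and the starting point, whose
  homology vanishes in the odd degree 2k+1. The word "reduced" matters for k = 0: the cycle to be
  filled over the overlap is then a boundary of 1-chains, so its augmentation is 0.\<close>

text \<open>Baer's argument for the injectivity of the rationals. The partial homomorphism is given
  by its graph \<open>R0\<close>, a subgroup of the product that is single-valued over 0. Zorn's
  lemma gives a maximal graph of this kind, and divisibility makes it total.\<close>

lemma additive_rat_extension:
  fixes R0 :: "('b::ab_group_add \<times> rat) set"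
  assumes zero: "(0, 0) \<in> R0"
    and diff: "\<And>x y r s. (x, r) \<in> R0 \<Longrightarrow> (y, s) \<in> R0 \<Longrightarrow> (x - y, r - s) \<in> R0"
    and fct: "\<And>r. (0, r) \<in> R0 \<Longrightarrow> r = 0"
  obtains g :: "'b \<Rightarrow> rat"
  where "\<And>x y. g (x + y) = g x + g y" "\<And>x r. (x, r) \<in> R0 \<Longrightarrow> g x = r"
proof -
  define good where "good R \<longleftrightarrow> (0, 0) \<in> R \<and> (\<forall>x y r s. (x, r) \<in> R \<longrightarrow> (y, s) \<in> R \<longrightarrow> (x - y, r - s) \<in> R)
     \<and> (\<forall>r. (0, r) \<in> R \<longrightarrow> r = 0)" for R :: "('b \<times> rat) set"
  define A where "A = {R. good R \<and> R0 \<subseteq> R}"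
  have "R0 \<in> A"
    using zero diff fct by (auto simp: A_def good_def)
  have "\<exists>U\<in>A. \<forall>X\<in>C. X \<subseteq> U" if C: "subset.chain A C" for C
  proof (cases "C = {}")
    case True
    with \<open>R0 \<in> A\<close> show ?thesis by auto
  next
    case False
    have CA: "C \<subseteq> A" and tot: "\<And>X Y. X \<in> C \<Longrightarrow> Y \<in> C \<Longrightarrow> X \<subseteq> Y \<or> Y \<subseteq> X"
      using C by (auto simp: subset_chain_def)
    have "(x - y, r - s) \<in> \<Union>C" if "(x, r) \<in> \<Union>C" "(y, s) \<in> \<Union>C" for x y r s
    proof -
      from that obtain X Y where XY: "X \<in> C" "Y \<in> C" "(x, r) \<in> X" "(y, s) \<in> Y"
        by blast
      then obtain Z where Z: "Z \<in> C" "(x, r) \<in> Z" "(y, s) \<in> Z"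
        using tot[of X Y] by blast
      then have "good Z"
        using CA by (auto simp: A_def)
      then have "(x - y, r - s) \<in> Z"
        using Z unfolding good_def by blast
      then show ?thesis
        using Z by blast
    qed
    then have "\<Union>C \<in> A"
      using CA False unfolding A_def good_def by blast
    then show ?thesis by blast
  qed
  from subset_Zorn[OF this] obtain R where "R \<in> A" and max: "\<And>X. X \<in> A \<Longrightarrow> R \<subseteq> X \<Longrightarrow> X = R"
    by blast
  then have R: "(0, 0) \<in> R" "\<And>x y r s. (x, r) \<in> R \<Longrightarrow> (y, s) \<in> R \<Longrightarrow> (x - y, r - s) \<in> R"
    "\<And>r. (0, r) \<in> R \<Longrightarrow> r = 0" "R0 \<subseteq> R"
    by (auto simp: A_def good_def)
  have uminus: "(- x, - r) \<in> R" if "(x, r) \<in> R" for x r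
    using R(2)[OF R(1) that] by simp
  have add: "(x + y, r + s) \<in> R" if "(x, r) \<in> R" "(y, s) \<in> R" for x y r s
    using R(2)[OF that(1) uminus[OF that(2)]] by simp
  \<comment> \<open>Integer multiples of \<open>x\<close> in a bare abelian group, by iterated
    addition.\<close>
  define zs where "zs j x = (if j \<ge> 0 then ((+) x ^^ nat j) 0 else - (((+) x ^^ nat (- j)) 0))" for j :: int and x :: 'b
  have zs_0: "zs 0 x = 0" and zs_1: "zs 1 x = x" for x
    by (simp_all add: zs_def)
  have zs_suc: "zs (j + 1) x = zs j x + x" for j x
  proof -
    consider n where "j = int n" | n where "j = - int (Suc n)"
      by (metis int_cases)
    then show ?thesis
    proof cases
      case 1
      then show ?thesis by (simp add: zs_def nat_add_distrib add.commute)
    next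
      case (2 n)
      then have "nat (- j) = Suc n" "nat (- (j + 1)) = n" "\<not> j \<ge> 0" "j + 1 \<ge> 0 \<longleftrightarrow> n = 0"
        by auto
      then show ?thesis using 2 by (cases "n = 0") (simp_all add: zs_def)
    qed
  qed
  have zs_add: "zs (i + j) x = zs i x + zs j x" for i j x
  proof (induction j rule: int_induct[where k = 0])
    case base
    show ?case by (simp add: zs_0)
  next
    case (step1 j)
    then show ?case using zs_suc[of "i + j" x] zs_suc[of j x] by (simp add: add.assoc)
  next
    case (step2 j)
    then show ?case using zs_suc[of "i + (j - 1)" x] zs_suc[of "j - 1" x]
      by (simp add: algebra_simps)
  qed
  have zs_diff: "zs (i - j) x = zs i x - zs j x" for i j x
    using zs_add[of "i - j" j x] by (simp add: algebra_simps)
  have zs_mult: "zs (i * j) x = zs i (zs j x)" for i j x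
  proof (induction i rule: int_induct[where k = 0])
    case base
    show ?case by (simp add: zs_0)
  next
    case (step1 i)
    then show ?case using zs_add[of "i * j" j x] zs_suc[of i "zs j x"] by (simp add: algebra_simps)
  next
    case (step2 i)
    then show ?case using zs_diff[of "i * j" j x] zs_diff[of i 1 "zs j x"] by (simp add: left_diff_distrib zs_diff zs_1)
  qed
  have zs_R: "(zs j x, of_int j * r) \<in> R" if "(x, r) \<in> R" for j x r
  proof (induction j rule: int_induct[where k = 0])
    case base
    show ?case using R(1) by (simp add: zs_0)
  next
    case (step1 j)
    then show ?case using add[OF step1(2) that] by (simp add: zs_suc ring_distribs)
  next
    case (step2 j)
    then show ?case using R(2)[OF step2(2) that] by (simp add: zs_diff zs_1 algebra_simps)
  qed
  have total: "\<exists>r. (x, r) \<in> R" for x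
  proof -
    \<comment> \<open>If some nonzero multiple \<open>m x\<close> already has a value
      \<open>r\<close>, the value of \<open>x\<close> must be \<open>r / m\<close>, which exists by
      divisibility. Otherwise only \<open>j = 0\<close> occurs, and any value would do; 0 is
      taken.\<close>
    obtain q where q: "\<And>j r. (zs j x, r) \<in> R \<Longrightarrow> r = of_int j * q"
    proof (cases "\<exists>m r. m \<noteq> 0 \<and> (zs m x, r) \<in> R")
      case True
      then obtain m r where m: "m \<noteq> 0" "(zs m x, r) \<in> R" by blast
      have "s = of_int j * (r / of_int m)" if "(zs j x, s) \<in> R" for j s
      proof -
        have "(zs (m * j) x, of_int m * s) \<in> R" "(zs (j * m) x, of_int j * r) \<in> R"
          using zs_R[OF that, of m] zs_R[OF m(2), of j] by (simp_all add: zs_mult)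
        then have "(0, of_int m * s - of_int j * r) \<in> R"
          using R(2) by (fastforce simp: mult.commute)
        then show ?thesis
          using R(3) m(1) by (fastforce simp: field_simps)
      qed
      then show ?thesis using that by blast
    next
      case False
      have "r = of_int j * 0" if "(zs j x, r) \<in> R" for j r
      proof -
        have "j = 0"
          using False that by blast
        then show ?thesis
          using R(3) that by (simp add: zs_0)
      qed
      then show ?thesis using that by blast
    qed
    \<comment> \<open>The graph generated by \<open>R\<close> and the pair \<open>(x, q)\<close>.
      The choice of \<open>q\<close> keeps it single-valued, so by maximality the pair was in
      \<open>R\<close> already.\<close>
    define R' where "R' = {(y + zs j x, r + of_int j * q) | y r j. (y, r) \<in> R}"
    have "R \<subseteq> R'"
    proof
      fix t
      assume "t \<in> R"
      then show "t \<in> R'"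
        unfolding R'_def
        by (cases t) (rule CollectI, rule exI[of _ "fst t"], rule exI[of _ "snd t"], rule exI[of _ "0::int"],
            simp add: zs_0)
    qed
    have "(a - b, r - s) \<in> R'" if ab: "(a, r) \<in> R'" "(b, s) \<in> R'" for a b r s
    proof -
      obtain y u j z w i where "(y, u) \<in> R" "(z, w) \<in> R" "a = y + zs j x" "r = u + of_int j * q"
        "b = z + zs i x" "s = w + of_int i * q"
        using ab unfolding R'_def by blast
      then show ?thesis
        unfolding R'_def using R(2)[of y u z w]
        by (intro CollectI exI[of _ "y - z"] exI[of _ "u - w"] exI[of _ "j - i"]) (simp add: zs_diff left_diff_distrib)
    qed
    moreover have "r = 0" if "(0, r) \<in> R'" for r
    proof -
      from that obtain y u j where y: "(y, u) \<in> R" "0 = y + zs j x" "r = u + of_int j * q"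
        unfolding R'_def by blast
      then have "y = zs (- j) x"
        using zs_diff[of 0 j x] by (metis add_right_cancel diff_add_cancel diff_0 zs_0)
      then show ?thesis
        using q y by force
    qed
    ultimately have "good R'"
      unfolding good_def using R(1) \<open>R \<subseteq> R'\<close> by (intro conjI allI impI) (blast+)
    then have "R' \<in> A"
      using R(4) \<open>R \<subseteq> R'\<close> unfolding A_def by blast
    then have "R' = R"
      using max \<open>R \<subseteq> R'\<close> by blast
    moreover have "(x, q) \<in> R'"
      unfolding R'_def
      by (rule CollectI, rule exI[of _ 0], rule exI[of _ 0], rule exI[of _ 1]) (simp add: zs_1 R(1))
    ultimately show ?thesis by blast
  qed
  then obtain g where g: "\<And>x. (x, g x) \<in> R"
    by metis
  have uniq: "r = s" if "(x, r) \<in> R" "(x, s) \<in> R" for x r s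
    using R(2)[OF that] R(3) by fastforce
  show ?thesis
  proof (rule that)
    show "g (x + y) = g x + g y" for x y
      using uniq[OF g add[OF g g]] .
    show "g x = r" if "(x, r) \<in> R0" for x r
      using uniq g that R(4) by blast
  qed
qed

subsection \<open>Torsion in singular homology\<close>

lemma frag_cmul_diff_right: "frag_cmul k (a - b) = frag_cmul k a - frag_cmul k b"
  by (rule poly_mapping_eqI) (simp add: lookup_minus right_diff_distrib)

lemma augmentation_superset:
  assumes "finite S" "Poly_Mapping.keys c \<subseteq> S"
  shows "augmentation c = (\<Sum>\<sigma>\<in>S. Poly_Mapping.lookup c \<sigma>)"
  unfolding augmentation_def
  by (rule sum.mono_neutral_left) (use assms in \<open>auto simp: in_keys_iff\<close>)

lemma augmentation_0 [simp]: "augmentation 0 = 0"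
  by (simp add: augmentation_def)

lemma augmentation_of [simp]: "augmentation (frag_of x) = 1"
  by (simp add: augmentation_def)

lemma augmentation_diff: "augmentation (a - b) = augmentation a - augmentation b"
proof -
  let ?S = "Poly_Mapping.keys a \<union> Poly_Mapping.keys b"
  have "augmentation (a - b) = (\<Sum>\<sigma>\<in>?S. Poly_Mapping.lookup (a - b) \<sigma>)"
    by (rule augmentation_superset) (use keys_diff[of a b] in auto)
  also have "\<dots> = (\<Sum>\<sigma>\<in>?S. Poly_Mapping.lookup a \<sigma>) - (\<Sum>\<sigma>\<in>?S. Poly_Mapping.lookup b \<sigma>)"
    by (simp add: lookup_minus sum_subtractf)
  also have "\<dots> = augmentation a - augmentation b"
    using augmentation_superset[of ?S a] augmentation_superset[of ?S b] by simp
  finally show ?thesis .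
qed

lemma augmentation_add: "augmentation (a + b) = augmentation a + augmentation b"
  using augmentation_diff[of "a + b" b] by simp

lemma augmentation_chain_map: "augmentation (chain_map p f c) = augmentation c"
proof (induction c rule: frag_induction[OF subset_UNIV])
  case (3 a b)
  then show ?case by (simp add: chain_map_diff augmentation_diff)
qed simp_all

lemma augmentation_boundary: "augmentation (chain_boundary (Suc 0) c) = 0"
proof (induction c rule: frag_induction[OF subset_UNIV])
  case (2 x)
  then show ?case by (simp add: chain_boundary_of augmentation_diff augmentation_add)
next
  case (3 a b)
  then show ?case by (simp add: chain_boundary_diff augmentation_diff)
qed simp

text \<open>Vanishing of rational homology, expressed with integral chains. The augmentation
  condition makes it reduced homology in degree 0.\<close>

definition torsion_homology :: "nat \<Rightarrow> 'a topology \<Rightarrow> bool" where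
  "torsion_homology p X \<longleftrightarrow>
     (\<forall>z. singular_relcycle p X {} z \<longrightarrow> (p = 0 \<longrightarrow> augmentation z = 0) \<longrightarrow>
       (\<exists>m. m \<noteq> 0 \<and> singular_relboundary p X {} (frag_cmul m z)))"

lemma torsion_homologyE:
  assumes "torsion_homology p X" "singular_relcycle p X {} z" "p = 0 \<longrightarrow> augmentation z = 0"
  obtains m where "m \<noteq> 0" "singular_relboundary p X {} (frag_cmul m z)"
  using assms unfolding torsion_homology_def by metis

text \<open>Over a point there is one simplex in each degree. For odd \<open>p\<close> the boundary
  of the one in degree \<open>p + 1\<close> has an odd number of alternating terms and equals the
  one in degree \<open>p\<close>, so every chain of degree \<open>p\<close> is a boundary.\<close>

lemma torsion_homology_singleton:
  assumes "topspace X = {a}" "odd p"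
  shows "torsion_homology p X"
  unfolding torsion_homology_def
proof (intro allI impI exI conjI)
  fix z
  assume "singular_relcycle p X {} z"
  then show "singular_relboundary p X {} (frag_cmul 1 z)"
    using assms by (simp add: singular_boundary_singleton singular_cycle_singleton)
qed simp

text \<open>A cycle of \<open>X\<close> is pushed to \<open>Y\<close>, a multiple of it is filled
  there, and the filling is brought back by \<open>g\<close>. Only the composite on \<open>X\<close>
  has to be homotopic to the identity, because the cycle starts and ends in
  \<open>X\<close>.\<close>

lemma torsion_homology_dominated:
  assumes "torsion_homology p Y" "continuous_map X Y f" "continuous_map Y X g"
    "homotopic_with (\<lambda>h. True) X X (g \<circ> f) id"
  shows "torsion_homology p X"
  unfolding torsion_homology_def
proof (intro allI impI)
  fix z
  assume z: "singular_relcycle p X {} z" "p = 0 \<longrightarrow> augmentation z = 0"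
  have "singular_relcycle p Y {} (chain_map p f z)"
    using singular_relcycle_chain_map[OF z(1) assms(2)] by blast
  moreover have "p = 0 \<longrightarrow> augmentation (chain_map p f z) = 0"
    using z(2) by (simp add: augmentation_chain_map)
  ultimately obtain m where m: "m \<noteq> 0" "singular_relboundary p Y {} (frag_cmul m (chain_map p f z))"
    by (rule torsion_homologyE[OF assms(1)])
  have 1: "singular_relboundary p X {} (frag_cmul m (chain_map p (g \<circ> f) z))"
    using singular_relboundary_chain_map[OF m(2) assms(3), of "{}"]
    by (simp add: chain_map_compose)
  have "homotopic_with (\<lambda>h. h \<in> {} \<rightarrow> {}) X X (g \<circ> f) id"
    using assms(4) by (rule homotopic_with_mono) auto
  from homotopic_imp_homologous_rel_chain_maps[OF this z(1)]
  have "singular_relboundary p X {} (chain_map p (g \<circ> f) z - z)"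
    using z(1) chain_map_ident[of p X z] by (simp add: homologous_rel_def singular_cycle)
  then have "singular_relboundary p X {} (frag_cmul m (chain_map p (g \<circ> f) z - z))"
    by (rule singular_relboundary_cmul)
  then have "singular_relboundary p X {} (frag_cmul m (chain_map p (g \<circ> f) z) - frag_cmul m z)"
    by (simp add: frag_cmul_diff_right)
  from singular_relboundary_diff[OF 1 this]
  have "singular_relboundary p X {} (frag_cmul m z)"
    by simp
  with m show "\<exists>m. m \<noteq> 0 \<and> singular_relboundary p X {} (frag_cmul m z)"
    by blast
qed

text \<open>The open set \<open>V\<close> serves only to subdivide the cycle. All fillings take
  place in \<open>U\<close>, \<open>W\<close> and their intersection, so \<open>W\<close> may be a
  closed set whose homotopy type is easy to see.\<close>

lemma torsion_homology_Mayer_Vietoris: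
  assumes U: "openin X U" and V: "openin X V" and cover: "topspace X \<subseteq> U \<union> V" and "V \<subseteq> W"
    and tU: "torsion_homology (Suc p) (subtopology X U)"
    and tW: "torsion_homology (Suc p) (subtopology X W)"
    and tUW: "torsion_homology p (subtopology X (U \<inter> W))"
  shows "torsion_homology (Suc p) X"
  unfolding torsion_homology_def
proof (intro allI impI)
  fix z
  assume z: "singular_relcycle (Suc p) X {} z"
  obtain c where c: "singular_relcycle (Suc p) X {} c" "homologous_rel (Suc p) X {} z c"
    "\<And>f. f \<in> Poly_Mapping.keys c \<Longrightarrow> \<exists>S\<in>{U, V}. f \<in> standard_simplex (Suc p) \<rightarrow> S"
    by (rule small_homologous_rel_relcycle_exists[of "{U, V}" X "Suc p" "{}" z]) (use U V cover z in auto)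
  \<comment> \<open>Simplices inside \<open>U\<close> are collected in \<open>d\<close>; by
    smallness the remaining ones, collected in \<open>e\<close>, lie in \<open>V\<close>.\<close>
  define A where "A = {f. f ` standard_simplex (Suc p) \<subseteq> U}"
  obtain d e where de: "Poly_Mapping.keys d \<subseteq> Poly_Mapping.keys c \<inter> A"
    "Poly_Mapping.keys e \<subseteq> Poly_Mapping.keys c - A" "d + e = c"
    using frag_split[of c "Poly_Mapping.keys c \<inter> A" "Poly_Mapping.keys c - A"] by blast
  have cX: "Poly_Mapping.keys c \<subseteq> singular_simplex_set (Suc p) X"
    using c(1) by (simp add: singular_cycle singular_chain_def)
  have "singular_chain (Suc p) X d" "singular_chain (Suc p) X e"
    using de(1,2) cX by (auto simp: singular_chain_def)
  have "\<forall>f\<in>Poly_Mapping.keys d. f ` standard_simplex (Suc p) \<subseteq> U"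
    using de(1) by (auto simp: A_def)
  with \<open>singular_chain (Suc p) X d\<close> have d: "singular_chain (Suc p) (subtopology X U) d"
    by (simp add: singular_chain_subtopology)
  have "f ` standard_simplex (Suc p) \<subseteq> V" if f: "f \<in> Poly_Mapping.keys e" for f
  proof -
    have "f \<in> Poly_Mapping.keys c" "\<not> f ` standard_simplex (Suc p) \<subseteq> U"
      using f de(2) by (auto simp: A_def)
    then show ?thesis
      using c(3)[of f] by (auto simp: image_subset_iff_funcset)
  qed
  with \<open>singular_chain (Suc p) X e\<close> have e: "singular_chain (Suc p) (subtopology X V) e"
    by (simp add: singular_chain_subtopology)
  have bde: "chain_boundary (Suc p) d = - chain_boundary (Suc p) e"
    using c(1) chain_boundary_add[of "Suc p" d e] de(3) by (simp add: singular_cycle add_eq_0_iff2)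
  let ?b = "chain_boundary (Suc p) d"
  have "singular_chain p (subtopology X U) ?b" "singular_chain p (subtopology X V) ?b"
    using singular_chain_boundary_alt[OF d] singular_chain_boundary_alt[OF e] bde
    by (simp_all add: singular_chain_minus)
  then have "singular_chain p (subtopology X (U \<inter> W)) ?b"
    using \<open>V \<subseteq> W\<close> unfolding singular_chain_subtopology by blast
  then have "singular_relcycle p (subtopology X (U \<inter> W)) {} ?b"
    using chain_boundary_boundary_alt[OF d] by (simp add: singular_cycle)
  moreover have "p = 0 \<longrightarrow> augmentation ?b = 0"
    by (simp add: augmentation_boundary)
  ultimately obtain m where m: "m \<noteq> 0" "singular_relboundary p (subtopology X (U \<inter> W)) {} (frag_cmul m ?b)"
    by (rule torsion_homologyE[OF tUW])
  then obtain w where w: "singular_chain (Suc p) (subtopology X (U \<inter> W)) w"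
    "chain_boundary (Suc p) w = frag_cmul m ?b"
    by (auto simp: singular_boundary)
  have wU: "singular_chain (Suc p) (subtopology X U) w" and wW: "singular_chain (Suc p) (subtopology X W) w"
    using w(1) by (auto elim: singular_chain_mono)
  have eW: "singular_chain (Suc p) (subtopology X W) e"
    using e \<open>V \<subseteq> W\<close> by (rule singular_chain_mono)
  \<comment> \<open>The chain \<open>w\<close> fills \<open>m\<close> times the common boundary, so
    it closes up \<open>m d\<close> inside \<open>U\<close> and, with the opposite sign,
    \<open>m e\<close> inside \<open>W\<close>.\<close>
  have "singular_relcycle (Suc p) (subtopology X U) {} (frag_cmul m d - w)"
    using d wU w(2) by (simp add: singular_cycle singular_chain_diff singular_chain_cmul
        chain_boundary_diff chain_boundary_cmul)
  then obtain k where k: "k \<noteq> 0"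
    "singular_relboundary (Suc p) (subtopology X U) {} (frag_cmul k (frag_cmul m d - w))"
    by (rule torsion_homologyE[OF tU]) simp
  have "singular_relcycle (Suc p) (subtopology X W) {} (frag_cmul m e + w)"
    using eW wW by (simp add: singular_cycle singular_chain_add singular_chain_cmul
        chain_boundary_add chain_boundary_cmul w(2) bde flip: frag_cmul_distrib2)
  then obtain j where j: "j \<noteq> 0"
    "singular_relboundary (Suc p) (subtopology X W) {} (frag_cmul j (frag_cmul m e + w))"
    by (rule torsion_homologyE[OF tW]) simp
  have lift: "singular_relboundary (Suc p) X {} a" if "singular_relboundary (Suc p) (subtopology X S) {} a" for S a
    using that by (auto simp: singular_boundary singular_chain_subtopology)
  \<comment> \<open>Cross-multiplying by \<open>j\<close> and \<open>k\<close> makes the two copies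
    of \<open>w\<close> cancel.\<close>
  have "singular_relboundary (Suc p) X {} (frag_cmul j (frag_cmul k (frag_cmul m d - w))
      + frag_cmul k (frag_cmul j (frag_cmul m e + w)))"
    by (intro singular_relboundary_add singular_relboundary_cmul lift[OF k(2)] lift[OF j(2)])
  also have "frag_cmul j (frag_cmul k (frag_cmul m d - w)) + frag_cmul k (frag_cmul j (frag_cmul m e + w))
      = frag_cmul (j * k * m) (d + e)"
    by (rule poly_mapping_eqI) (simp add: lookup_minus lookup_add algebra_simps)
  finally have 1: "singular_relboundary (Suc p) X {} (frag_cmul (j * k * m) c)"
    using de(3) by simp
  have "singular_relboundary (Suc p) X {} (frag_cmul (j * k * m) (z - c))"
    using c(2) unfolding homologous_rel_def by (rule singular_relboundary_cmul)
  from singular_relboundary_add[OF this 1]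
  have "singular_relboundary (Suc p) X {} (frag_cmul (j * k * m) z)"
    by (simp add: frag_cmul_diff_right)
  then show "\<exists>m. m \<noteq> 0 \<and> singular_relboundary (Suc p) X {} (frag_cmul m z)"
    using m(1) k(1) j(1) by (intro exI[of _ "j * k * m"]) simp
qed

section \<open>Rational cocycles and the passage between cohomology and torsion\<close>

lemma carrier_cochain_group:
  "\<phi> \<in> carrier (cochain_group p X) \<longleftrightarrow> \<phi> \<in> extensional (singular_chain_set p X) \<and>
     (\<forall>c d. singular_chain p X c \<longrightarrow> singular_chain p X d \<longrightarrow> \<phi> (c + d) = \<phi> c + \<phi> d)"
  by (auto simp: cochain_group_def hom_def additive_group_def Pi_iff)

lemma mult_cochain_group:
  "\<phi> \<otimes>\<^bsub>cochain_group p X\<^esub> \<psi> = (\<lambda>c\<in>singular_chain_set p X. \<phi> c + \<psi> c)"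
  by (simp add: cochain_group_def)

lemma one_cochain_group: "\<one>\<^bsub>cochain_group p X\<^esub> = (\<lambda>c\<in>singular_chain_set p X. 0)"
  by (simp add: cochain_group_def)

lemma cocycles_iff:
  "\<phi> \<in> cocycles p X \<longleftrightarrow> \<phi> \<in> carrier (cochain_group p X) \<and>
     (\<forall>c. singular_chain (Suc p) X c \<longrightarrow> \<phi> (chain_boundary (Suc p) c) = 0)"
proof -
  have "coboundary p X \<phi> = (\<lambda>c\<in>singular_chain_set (Suc p) X. 0) \<longleftrightarrow>
      (\<forall>c. singular_chain (Suc p) X c \<longrightarrow> \<phi> (chain_boundary (Suc p) c) = 0)"
    by (auto simp: coboundary_def fun_eq_iff restrict_def)
  then show ?thesis
    by (simp add: cocycles_def kernel_def cochain_group_def)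
qed

lemma comm_group_cocycles: "comm_group ((cochain_group p X)\<lparr>carrier := cocycles p X\<rparr>)"
proof (rule comm_groupI, goal_cases)
  case (1 \<phi> \<psi>)
  then show ?case
    by (auto simp: cocycles_iff carrier_cochain_group mult_cochain_group singular_chain_boundary_alt
        singular_chain_add)
next
  case 2
  then show ?case
    by (auto simp: cocycles_iff carrier_cochain_group one_cochain_group singular_chain_boundary_alt
        singular_chain_add)
next
  case (3 \<phi> \<psi> \<chi>)
  then show ?case
    by (auto simp: cochain_group_def fun_eq_iff restrict_def)
next
  case (4 \<phi> \<psi>)
  then show ?case
    by (auto simp: cochain_group_def fun_eq_iff restrict_def)
next
  case (5 \<phi>)
  then have "\<phi> \<in> extensional (singular_chain_set p X)"
    by (simp add: cocycles_iff carrier_cochain_group)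
  then show ?case
    by (auto simp: cochain_group_def fun_eq_iff restrict_def extensional_def)
next
  case (6 \<phi>)
  have "(\<lambda>c\<in>singular_chain_set p X. - \<phi> c) \<in> cocycles p X"
    using 6 by (auto simp: cocycles_iff carrier_cochain_group singular_chain_boundary_alt
        singular_chain_add)
  moreover have "(\<lambda>c\<in>singular_chain_set p X. - \<phi> c) \<otimes>\<^bsub>cochain_group p X\<^esub> \<phi> = \<one>\<^bsub>cochain_group p X\<^esub>"
    by (auto simp: cochain_group_def fun_eq_iff restrict_def)
  ultimately show ?case
    by auto
qed

lemma trivial_group_Mod_self:
  assumes "group G"
  shows "trivial_group (G Mod carrier G)"
proof -
  interpret group G by fact
  have "carrier G \<lhd> G"
    by (simp add: normal_inv_iff subgroup_self)
  moreover have "carrier G #>\<^bsub>G\<^esub> x = carrier G" if "x \<in> carrier G" for x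
    using that by (simp add: coset_join2 subgroup_self)
  then have "carrier (G Mod carrier G) = {carrier G}"
    unfolding carrier_FactGroup by auto
  ultimately show ?thesis
    by (simp add: trivial_group_def normal.factorgroup_is_group)
qed

text \<open>The unit of \<open>G Mod B\<close> is \<open>B\<close> itself by definition, so
  triviality forces the coset of \<open>x\<close> to be \<open>B\<close>; since \<open>B\<close>
  contains the unit of \<open>G\<close>, this coset contains \<open>x\<close>.\<close>

lemma trivial_group_ModD:
  assumes "group G" "trivial_group (G Mod B)" "\<one>\<^bsub>G\<^esub> \<in> B" "x \<in> carrier G"
  shows "x \<in> B"
proof -
  have "B #>\<^bsub>G\<^esub> x \<in> carrier (G Mod B)"
    using assms by (simp add: carrier_FactGroup)
  then have "B #>\<^bsub>G\<^esub> x = B"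
    using assms(2) by (simp add: trivial_group_def)
  moreover have "\<one>\<^bsub>G\<^esub> \<otimes>\<^bsub>G\<^esub> x \<in> B #>\<^bsub>G\<^esub> x"
    using assms(3) by (auto simp: r_coset_def)
  ultimately show ?thesis
    using assms(1,4) by (simp add: group.is_monoid monoid.l_one)
qed

text \<open>A cocycle vanishes on torsion classes because its values are rational, hence here on all
  cycles. It therefore factors through the boundary map, and the factor extends from the boundaries
  to all chains by injectivity of the rationals.\<close>

lemma trivial_cohomology_group_if_torsion:
  assumes tors: "torsion_homology (Suc p) X"
  shows "trivial_group (cohomology_group (Suc p) X)"
proof -
  have "\<phi> \<in> coboundaries (Suc p) X" if \<phi>: "\<phi> \<in> cocycles (Suc p) X" for \<phi>
  proof -
    have ext: "\<phi> \<in> extensional (singular_chain_set (Suc p) X)"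
      and add: "\<And>c d. singular_chain (Suc p) X c \<Longrightarrow> singular_chain (Suc p) X d \<Longrightarrow> \<phi> (c + d) = \<phi> c + \<phi> d"
      and bd: "\<And>c. singular_chain (Suc (Suc p)) X c \<Longrightarrow> \<phi> (chain_boundary (Suc (Suc p)) c) = 0"
      using \<phi> by (auto simp: cocycles_iff carrier_cochain_group)
    have 0: "\<phi> 0 = 0"
      using add[of 0 0] by simp
    have diff: "\<phi> (c - d) = \<phi> c - \<phi> d" if "singular_chain (Suc p) X c" "singular_chain (Suc p) X d" for c d
      using add[of "c - d" d] that by (simp add: singular_chain_diff)
    have cmul: "\<phi> (frag_cmul j c) = of_int j * \<phi> c" if c: "singular_chain (Suc p) X c" for j c
    proof (induction j rule: int_induct[where k = 0])
      case base
      show ?case by (simp add: 0)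
    next
      case (step1 j)
      then show ?case
        using add[OF singular_chain_cmul[OF c, of j] c] by (simp add: frag_cmul_distrib ring_distribs)
    next
      case (step2 j)
      then show ?case
        using diff[OF singular_chain_cmul[OF c, of j] c] by (simp add: frag_cmul_diff_distrib left_diff_distrib)
    qed
    have cyc: "\<phi> z = 0" if z: "singular_relcycle (Suc p) X {} z" for z
    proof -
      obtain m where m: "m \<noteq> 0" "singular_relboundary (Suc p) X {} (frag_cmul m z)"
        by (rule torsion_homologyE[OF tors z]) simp
      then have "\<phi> (frag_cmul m z) = 0"
        using bd unfolding singular_boundary by metis
      then show ?thesis
        using m(1) z by (simp add: cmul singular_cycle)
    qed
    \<comment> \<open>The graph of the map sending the boundary of \<open>c\<close> to
      \<open>\<phi> c\<close>; single-valued because \<open>\<phi>\<close> vanishes on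
      cycles.\<close>
    define R where "R = {(chain_boundary (Suc p) c, \<phi> c) | c. singular_chain (Suc p) X c}"
    obtain g where g: "\<And>x y. g (x + y) = g x + g y" "\<And>x r. (x, r) \<in> R \<Longrightarrow> g x = r"
    proof (rule additive_rat_extension[of R])
      show "(0, 0) \<in> R"
        unfolding R_def using 0 by (intro CollectI exI[of _ 0]) simp
      show "(x - y, r - s) \<in> R" if xy: "(x, r) \<in> R" "(y, s) \<in> R" for x y r s
      proof -
        from xy obtain c d where "singular_chain (Suc p) X c" "singular_chain (Suc p) X d"
          "x = chain_boundary (Suc p) c" "r = \<phi> c" "y = chain_boundary (Suc p) d" "s = \<phi> d"
          unfolding R_def by blast
        then show ?thesis
          unfolding R_def
          by (intro CollectI exI[of _ "c - d"]) (simp add: diff chain_boundary_diff singular_chain_diff)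
      qed
      show "r = 0" if "(0, r) \<in> R" for r
      proof -
        from that obtain c where "singular_chain (Suc p) X c" "0 = chain_boundary (Suc p) c" "r = \<phi> c"
          unfolding R_def by blast
        then show ?thesis
          using cyc[of c] by (simp add: singular_cycle)
      qed
    qed blast
    define \<psi> where "\<psi> = restrict g (singular_chain_set p X)"
    have "\<psi> \<in> carrier (cochain_group p X)"
      by (auto simp: carrier_cochain_group \<psi>_def g(1) singular_chain_add)
    moreover have "coboundary p X \<psi> = \<phi>"
    proof
      fix c
      have "g (chain_boundary (Suc p) c) = \<phi> c" if "singular_chain (Suc p) X c"
        by (rule g(2)) (use that in \<open>auto simp: R_def\<close>)
      then show "coboundary p X \<psi> c = \<phi> c"
        using ext by (auto simp: coboundary_def \<psi>_def singular_chain_boundary_alt extensional_def restrict_def)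
    qed
    ultimately show ?thesis
      unfolding coboundaries_def by auto
  qed
  moreover have "coboundary p X \<psi> \<in> cocycles (Suc p) X" if \<psi>: "\<psi> \<in> carrier (cochain_group p X)" for \<psi>
  proof -
    have "\<psi> 0 = 0"
      using \<psi> unfolding carrier_cochain_group by (metis add_cancel_right_right singular_chain_0 add.right_neutral)
    then show ?thesis
      using \<psi> by (auto simp: cocycles_iff carrier_cochain_group coboundary_def singular_chain_boundary_alt
          singular_chain_add chain_boundary_add chain_boundary_boundary_alt)
  qed
  ultimately have "coboundaries (Suc p) X = cocycles (Suc p) X"
    by (auto simp: coboundaries_def)
  then show ?thesis
    using trivial_group_Mod_self[OF comm_group.axioms(2)[OF comm_group_cocycles[of "Suc p" X]]]
    by (simp add: cohomology_group_def)
qed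

text \<open>A cycle without a multiple that bounds would be detected by a cocycle with value 1 on
  it. But every cocycle is a reduced coboundary and so vanishes on the cycle; in degree 0 this is
  where its augmentation being 0 is used.\<close>

lemma torsion_homology_if_trivial_reduced:
  assumes triv: "trivial_group (reduced_cohomology_group p X)"
  shows "torsion_homology p X"
  unfolding torsion_homology_def
proof (intro allI impI)
  fix z
  assume z: "singular_relcycle p X {} z" "p = 0 \<longrightarrow> augmentation z = 0"
  let ?G = "(cochain_group p X)\<lparr>carrier := cocycles p X\<rparr>"
  have one: "\<one>\<^bsub>?G\<^esub> \<in> reduced_coboundaries p X"
  proof (cases p)
    case 0
    then show ?thesis
      by (auto simp: cochain_group_def reduced_coboundaries_def fun_eq_iff intro!: exI[of _ 0])
  next
    case (Suc q)
    have "(\<lambda>c\<in>singular_chain_set q X. 0) \<in> carrier (cochain_group q X)"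
      by (auto simp: carrier_cochain_group singular_chain_add)
    moreover have "coboundary q X (\<lambda>c\<in>singular_chain_set q X. 0) = (\<lambda>c\<in>singular_chain_set (Suc q) X. 0)"
      by (auto simp: coboundary_def fun_eq_iff restrict_def singular_chain_boundary_alt)
    ultimately show ?thesis
      unfolding reduced_coboundaries_def Suc by (force simp: cochain_group_def)
  qed
  have vanish: "\<phi> z = 0" if \<phi>: "\<phi> \<in> cocycles p X" for \<phi>
  proof -
    have "\<phi> \<in> reduced_coboundaries p X"
      using trivial_group_ModD[OF comm_group.axioms(2)[OF comm_group_cocycles[of p X]] _ one, of \<phi>] triv \<phi>
      by (simp add: reduced_cohomology_group_def)
    then show ?thesis
    proof (cases p)
      case 0
      with \<open>\<phi> \<in> reduced_coboundaries p X\<close> z show ?thesis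
        by (auto simp: reduced_coboundaries_def singular_cycle)
    next
      case (Suc q)
      with \<open>\<phi> \<in> reduced_coboundaries p X\<close> obtain \<psi> where \<psi>: "\<psi> \<in> carrier (cochain_group q X)" "\<phi> = coboundary q X \<psi>"
        by (auto simp: reduced_coboundaries_def)
      have "\<psi> 0 = 0"
        using \<psi>(1) unfolding carrier_cochain_group by (metis add_cancel_right_right singular_chain_0 add.right_neutral)
      then show ?thesis
        using z(1) Suc by (simp add: \<psi>(2) coboundary_def singular_cycle)
    qed
  qed
  show "\<exists>m. m \<noteq> 0 \<and> singular_relboundary p X {} (frag_cmul m z)"
  proof (rule ccontr)
    assume non: "\<nexists>m. m \<noteq> 0 \<and> singular_relboundary p X {} (frag_cmul m z)"
    \<comment> \<open>The homomorphism that kills boundaries and sends \<open>z\<close> to 1, on the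
      subgroup they generate; it is single-valued exactly because no nonzero multiple of
      \<open>z\<close> bounds.\<close>
    define R where "R = {(b + frag_cmul j z, rat_of_int j) | b j. singular_relboundary p X {} b}"
    obtain g where g: "\<And>x y. g (x + y) = g x + g y" "\<And>x r. (x, r) \<in> R \<Longrightarrow> g x = r"
    proof (rule additive_rat_extension[of R])
      show "(0, 0) \<in> R"
        unfolding R_def by (intro CollectI exI[of _ 0]) simp
      show "(x - y, r - s) \<in> R" if xy: "(x, r) \<in> R" "(y, s) \<in> R" for x y r s
      proof -
        from xy obtain b j c i where "singular_relboundary p X {} b" "singular_relboundary p X {} c"
          "x = b + frag_cmul j z" "r = rat_of_int j" "y = c + frag_cmul i z" "s = rat_of_int i"
          unfolding R_def by blast
        then show ?thesis
          unfolding R_def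
          by (intro CollectI exI[of _ "b - c"] exI[of _ "j - i"])
            (simp add: singular_relboundary_diff frag_cmul_diff_distrib)
      qed
      show "r = 0" if "(0, r) \<in> R" for r
      proof -
        from that obtain b j where b: "singular_relboundary p X {} b" "0 = b + frag_cmul j z" "r = rat_of_int j"
          unfolding R_def by blast
        then have "frag_cmul j z = - b"
          by (simp add: add_eq_0_iff)
        then have "singular_relboundary p X {} (frag_cmul j z)"
          using b(1) by (simp add: singular_relboundary_minus)
        then show ?thesis
          using non b(3) by auto
      qed
    qed blast
    have "g b = 0" if "singular_relboundary p X {} b" for b
      by (rule g(2)) (use that in \<open>auto simp: R_def intro!: exI[of _ b] exI[of _ 0]\<close>)
    then have "restrict g (singular_chain_set p X) \<in> cocycles p X"
      by (auto simp: cocycles_iff carrier_cochain_group g(1) singular_chain_add singular_boundary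
          singular_chain_boundary_alt)
    moreover have "g z = 1"
      by (rule g(2)) (auto simp: R_def intro!: exI[of _ 0] exI[of _ 1])
    ultimately show False
      using vanish z(1) by (fastforce simp: singular_cycle)
  qed
qed

subsection \<open>Facet normals of lattice polytopes\<close>

lemma int_span_base: "x \<in> S \<Longrightarrow> x \<in> int_span S"
  unfolding int_span_def by (intro CollectI exI[of _ "{x}"] exI[of _ "\<lambda>_. 1"]) simp

lemma int_span_diff:
  assumes "x \<in> int_span S" "y \<in> int_span S"
  shows "x - y \<in> int_span S"
proof -
  from assms(1) obtain A c where A: "finite A" "A \<subseteq> S" "x = (\<Sum>v\<in>A. of_int (c v) *\<^sub>R v)"
    unfolding int_span_def by blast
  from assms(2) obtain B d where B: "finite B" "B \<subseteq> S" "y = (\<Sum>v\<in>B. of_int (d v) *\<^sub>R v)"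
    unfolding int_span_def by blast
  define c' where "c' v = (if v \<in> A then c v else 0)" for v
  define d' where "d' v = (if v \<in> B then d v else 0)" for v
  have "x = (\<Sum>v\<in>A \<union> B. of_int (c' v) *\<^sub>R v)"
    unfolding A(3) c'_def by (rule sum.mono_neutral_cong_left) (use A B in auto)
  moreover have "y = (\<Sum>v\<in>A \<union> B. of_int (d' v) *\<^sub>R v)"
    unfolding B(3) d'_def by (rule sum.mono_neutral_cong_left) (use A B in auto)
  ultimately have "x - y = (\<Sum>v\<in>A \<union> B. of_int (c' v - d' v) *\<^sub>R v)"
    by (simp add: sum_subtractf scaleR_diff_left)
  then show ?thesis
    unfolding int_span_def using A B by (intro CollectI exI[of _ "A \<union> B"] exI[of _ "\<lambda>v. c' v - d' v"]) simp
qed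

lemma int_span_subset_span: "int_span S \<subseteq> span S"
  unfolding int_span_def by (auto intro!: span_sum span_scale intro: span_base)

lemma span_int_span: "span (int_span S) = span S"
  using span_minimal[OF int_span_subset_span subspace_span, of S] span_mono[of S "int_span S"] int_span_base
  by blast

lemma rat_common_denominator:
  fixes h :: "'b \<Rightarrow> rat"
  assumes "finite B"
  obtains N :: int where "N > 0" "\<And>b. b \<in> B \<Longrightarrow> of_int N * h b \<in> \<int>"
proof -
  have "\<exists>N::int. N > 0 \<and> (\<forall>b\<in>B. of_int N * h b \<in> \<int>)"
    using assms
  proof (induction B rule: finite_induct)
    case empty
    show ?case by (intro exI[of _ 1]) simp
  next
    case (insert x B)
    then obtain N :: int where N: "N > 0" "\<forall>b\<in>B. of_int N * h b \<in> \<int>"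
      by blast
    obtain p q where pq: "quotient_of (h x) = (p, q)"
      by fastforce
    then have q: "q > 0" "h x = of_int p / of_int q"
      by (simp_all add: quotient_of_denom_pos quotient_of_div)
    have "of_int (N * q) * h b \<in> \<int>" if "b \<in> insert x B" for b
    proof (cases "b = x")
      case True
      then have "of_int (N * q) * h b = of_int (N * p)"
        using q by simp
      then show ?thesis by (metis Ints_of_int)
    next
      case False
      then have "of_int N * h b \<in> \<int>"
        using N that by auto
      then have "of_int q * (of_int N * h b) \<in> \<int>"
        by (rule Ints_mult[OF Ints_of_int])
      then show ?thesis by (simp add: mult_ac)
    qed
    then show ?case
      using N(1) q(1) by (intro exI[of _ "N * q"]) simp
  qed
  then show ?thesis
    using that by blast
qed

text \<open>The vector \<open>adjoint g 1\<close> represents the linear extension \<open>g\<close>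
  of \<open>f\<close>; its projection to \<open>span B\<close> has the same inner products with
  \<open>B\<close>.\<close>

lemma inner_realize_on_independent:
  fixes B :: "'a::euclidean_space set"
  assumes "independent B"
  obtains y where "y \<in> span B" "\<And>b. b \<in> B \<Longrightarrow> y \<bullet> b = f b"
proof -
  obtain g :: "'a \<Rightarrow> real" where g: "linear g" "\<And>b. b \<in> B \<Longrightarrow> g b = f b"
    using linear_independent_extend[OF assms, of f] by blast
  obtain y z where yz: "y \<in> span B" "\<And>w. w \<in> span B \<Longrightarrow> orthogonal z w" "adjoint g 1 = y + z"
    using orthogonal_subspace_decomp_exists[of B "adjoint g 1"] by metis
  have "y \<bullet> b = f b" if "b \<in> B" for b
  proof -
    have "z \<bullet> b = 0"
      using yz(2)[of b] that by (simp add: orthogonal_def span_base)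
    then have "y \<bullet> b = adjoint g 1 \<bullet> b"
      by (simp add: yz(3) inner_add_left)
    also have "\<dots> = g b"
      using adjoint_works[OF g(1), of b 1] by (simp add: inner_commute)
    finally show ?thesis using g(2)[OF that] by simp
  qed
  with yz(1) that show ?thesis by blast
qed

section \<open>The dual lattice of a full-dimensional lattice polytope\<close>

locale lattice_full_polytope =
  fixes M P :: "'a::euclidean_space set" and n :: nat
  assumes lattice: "lattice_of_rank n M"
    and polytope: "lattice_polytope M P"
    and full_dim: "aff_dim P = int n"
begin

abbreviation N :: "'a set" where "N \<equiv> dual_lattice M"

definition B where "B = (SOME B. independent B \<and> card B = n \<and> M = int_span B)"

lemma B: "independent B" "card B = n" "M = int_span B" "finite B"
proof -
  have "\<exists>B. independent B \<and> card B = n \<and> M = int_span B"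
    using lattice by (auto simp: lattice_of_rank_def)
  from someI_ex[OF this] show 1: "independent B" "card B = n" "M = int_span B"
    unfolding B_def by blast+
  from 1(1) show "finite B"
    by (rule independent_imp_finite)
qed

lemma span_B: "span B = span M"
  using B(3) span_int_span by metis

lemma dim_span_M: "dim (span M) = n"
  using B span_B by (metis dim_eq_card_independent dim_span)

lemma lattice_diff: "x \<in> M \<Longrightarrow> y \<in> M \<Longrightarrow> x - y \<in> M"
  using int_span_diff[of x B y] B(3) by metis

lemma latticeE:
  assumes "m \<in> M"
  obtains A c where "A \<subseteq> B" "m = (\<Sum>v\<in>A. of_int (c v) *\<^sub>R v)"
proof -
  have "m \<in> int_span B"
    using assms B(3) by metis
  then show ?thesis
    using that unfolding int_span_def by blast
qed

lemma dual_subset: "N \<subseteq> span M"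
  by (auto simp: dual_lattice_def)

lemma dual_0: "0 \<in> N"
  by (simp add: dual_lattice_def span_zero)

lemma dual_add: "x \<in> N \<Longrightarrow> y \<in> N \<Longrightarrow> x + y \<in> N"
  by (auto simp: dual_lattice_def inner_add_left span_add)

lemma dual_scale: "x \<in> N \<Longrightarrow> of_int j *\<^sub>R x \<in> N"
  by (auto simp: dual_lattice_def span_scale)

lemma dual_minus: "x \<in> N \<Longrightarrow> - x \<in> N"
  using dual_scale[of x "-1"] by simp

lemma dual_latticeI:
  assumes "y \<in> span M" "\<And>b. b \<in> B \<Longrightarrow> y \<bullet> b \<in> \<int>"
  shows "y \<in> N"
proof -
  have "y \<bullet> m \<in> \<int>" if "m \<in> M" for m
  proof -
    from that obtain A c where A: "A \<subseteq> B" "m = (\<Sum>v\<in>A. of_int (c v) *\<^sub>R v)"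
      by (rule latticeE)
    have "y \<bullet> m = (\<Sum>v\<in>A. of_int (c v) * (y \<bullet> v))"
      by (simp add: A(2) inner_sum_right)
    also have "\<dots> \<in> \<int>"
      using A(1) assms(2) by (auto intro!: Ints_sum)
    finally show ?thesis .
  qed
  with assms(1) show ?thesis by (simp add: dual_lattice_def)
qed

text \<open>An additive map from the reals to the rationals, applied to the values of \<open>a\<close> on a basis, turns
  a real normal of a set of lattice vectors into a rational one.\<close>

lemma dual_vector_annihilating:
  assumes a: "a \<in> span M" "a \<noteq> 0"
  obtains y where "y \<in> N" "y \<noteq> 0" "\<And>d. d \<in> M \<Longrightarrow> a \<bullet> d = 0 \<Longrightarrow> y \<bullet> d = 0"
proof -
  obtain b0 where b0: "b0 \<in> B" "a \<bullet> b0 \<noteq> 0"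
  proof (rule ccontr)
    assume "\<not> thesis"
    then have "\<And>b. b \<in> B \<Longrightarrow> orthogonal a b"
      using that by (auto simp: orthogonal_def)
    then have "orthogonal a a"
      using orthogonal_to_span[of a B a] a(1) span_B by simp
    then show False using a(2) by (simp add: orthogonal_self)
  qed
  \<comment> \<open>Prescribing the value 1 at \<open>a \<bullet> b0\<close> keeps the rational
    normal from being zero.\<close>
  define R where "R = {(of_int j * (a \<bullet> b0), rat_of_int j) | j. True}"
  obtain g where g: "\<And>x y. g (x + y) = g x + g y" "\<And>x r. (x, r) \<in> R \<Longrightarrow> g x = r"
  proof (rule additive_rat_extension[of R])
    show "(0, 0) \<in> R"
      unfolding R_def by (intro CollectI exI[of _ 0]) simp
    show "(x - y, r - s) \<in> R" if xy: "(x, r) \<in> R" "(y, s) \<in> R" for x y r s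
    proof -
      from xy obtain i j where "x = of_int i * (a \<bullet> b0)" "r = of_int i" "y = of_int j * (a \<bullet> b0)" "s = of_int j"
        unfolding R_def by blast
      then show ?thesis
        unfolding R_def by (intro CollectI exI[of _ "i - j"]) (simp add: left_diff_distrib)
    qed
    show "r = 0" if "(0, r) \<in> R" for r
      using that b0(2) unfolding R_def by auto
  qed blast
  have g_b0: "g (a \<bullet> b0) = 1"
    by (rule g(2)) (unfold R_def, intro CollectI exI[of _ 1], simp)
  have g0: "g 0 = 0"
    using g(1)[of 0 0] by simp
  have gm: "g (- x) = - g x" for x
    using g(1)[of x "- x"] g0 by (simp add: eq_neg_iff_add_eq_0 add.commute)
  have gn: "g (of_nat k * x) = of_nat k * g x" for k x
    by (induction k) (simp_all add: g0 g(1) ring_distribs)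
  have gz: "g (of_int j * x) = of_int j * g x" for j x
    by (cases j rule: int_cases2) (simp_all add: gn gm)
  have gs: "g (\<Sum>v\<in>A. f v) = (\<Sum>v\<in>A. g (f v))" for A :: "'a set" and f
    by (induction A rule: infinite_finite_induct) (simp_all add: g0 g(1))
  obtain D :: int where D: "D > 0" "\<And>b. b \<in> B \<Longrightarrow> of_int D * g (a \<bullet> b) \<in> \<int>"
    using rat_common_denominator[OF B(4), of "\<lambda>b. g (a \<bullet> b)"] by blast
  obtain y where y: "y \<in> span B" "\<And>b. b \<in> B \<Longrightarrow> y \<bullet> b = of_rat (of_int D * g (a \<bullet> b))"
    using inner_realize_on_independent[OF B(1), of "\<lambda>b. of_rat (of_int D * g (a \<bullet> b))"] by blast
  show thesis
  proof (rule that)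
    have "real_of_rat q \<in> \<int>" if "q \<in> \<int>" for q
      using that by (auto elim!: Ints_cases)
    then show "y \<in> N"
      using y D(2) span_B by (intro dual_latticeI) auto
    show "y \<noteq> 0"
      using y(2)[OF b0(1)] D(1) g_b0 by auto
    fix d
    assume d: "d \<in> M" "a \<bullet> d = 0"
    from d(1) obtain A c where A: "A \<subseteq> B" "d = (\<Sum>v\<in>A. of_int (c v) *\<^sub>R v)"
      by (rule latticeE)
    have "y \<bullet> d = (\<Sum>v\<in>A. of_int (c v) * (y \<bullet> v))"
      by (simp add: A(2) inner_sum_right)
    also have "\<dots> = (\<Sum>v\<in>A. of_rat (of_int (c v) * (of_int D * g (a \<bullet> v))))"
      using A(1) y(2) by (intro sum.cong) (auto simp: of_rat_mult)
    also have "\<dots> = of_rat (\<Sum>v\<in>A. of_int (c v) * (of_int D * g (a \<bullet> v)))"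
      by (simp only: of_rat_sum)
    also have "(\<Sum>v\<in>A. of_int (c v) * (of_int D * g (a \<bullet> v))) = of_int D * g (\<Sum>v\<in>A. of_int (c v) * (a \<bullet> v))"
      by (simp only: gs gz sum_distrib_left mult.left_commute)
    also have "(\<Sum>v\<in>A. of_int (c v) * (a \<bullet> v)) = a \<bullet> d"
      by (simp add: A(2) inner_sum_right)
    finally show "y \<bullet> d = 0"
      using d(2) g0 by simp
  qed
qed

lemma lattice_vector_positive:
  assumes "y \<in> span M" "y \<noteq> 0"
  obtains m where "m \<in> M" "y \<bullet> m > 0"
proof -
  have "\<exists>m\<in>M. y \<bullet> m \<noteq> 0"
  proof (rule ccontr)
    assume "\<not> ?thesis"
    then have "\<And>m. m \<in> M \<Longrightarrow> orthogonal y m"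
      by (auto simp: orthogonal_def)
    then have "orthogonal y y"
      using orthogonal_to_span[of y M y] assms(1) by simp
    then show False using assms(2) by (simp add: orthogonal_self)
  qed
  then obtain m where m: "m \<in> M" "y \<bullet> m \<noteq> 0" by blast
  have "- m \<in> M"
    using lattice_diff[OF lattice_diff[OF m(1) m(1)] m(1)] by simp
  with m that show ?thesis
    by (metis inner_minus_right linorder_neqE_linordered_idom neg_0_less_iff_less)
qed

section \<open>Primitive vectors on a ray\<close>

text \<open>Positive multiples of \<open>y\<close> in the dual lattice take positive integer values
  at a fixed lattice vector \<open>m\<close>. One with the least value is primitive: dividing it by
  \<open>k\<close> inside the lattice divides the value by \<open>k\<close>.\<close>

lemma primitive_multiple_exists:
  assumes "y \<in> N" "y \<noteq> 0"
  obtains c where "c > 0" "primitive_vector N (c *\<^sub>R y)"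
proof -
  obtain m where m: "m \<in> M" "y \<bullet> m > 0"
    using lattice_vector_positive assms dual_subset by blast
  define Q where "Q c \<longleftrightarrow> c > 0 \<and> c *\<^sub>R y \<in> N" for c
  define f where "f c = nat \<lfloor>c * (y \<bullet> m)\<rfloor>" for c
  have f: "real (f c) = c * (y \<bullet> m)" if "Q c" for c
  proof -
    have "(c *\<^sub>R y) \<bullet> m \<in> \<int>"
      using that m(1) by (auto simp: Q_def dual_lattice_def)
    then obtain z where "c * (y \<bullet> m) = of_int z"
      by (auto elim: Ints_cases)
    moreover have "c * (y \<bullet> m) > 0"
      using that m(2) by (simp add: Q_def)
    ultimately show ?thesis
      by (simp add: f_def)
  qed
  have "Q 1"
    using assms by (simp add: Q_def)
  then obtain c where c: "Q c" "\<And>d. Q d \<Longrightarrow> f c \<le> f d"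
    using ex_has_least_nat[of Q 1 f] by blast
  have "primitive_vector N (c *\<^sub>R y)"
    unfolding primitive_vector_def
  proof (intro conjI ballI allI impI)
    show "c *\<^sub>R y \<in> N" "c *\<^sub>R y \<noteq> 0"
      using c(1) assms(2) by (auto simp: Q_def)
    fix z and k :: nat
    assume z: "z \<in> N" "c *\<^sub>R y = real k *\<^sub>R z"
    have k: "k > 0"
      using z(2) c(1) assms(2) by (cases k) (auto simp: Q_def)
    have "(c / real k) *\<^sub>R y = inverse (real k) *\<^sub>R (c *\<^sub>R y)"
      by (simp add: divide_inverse mult.commute)
    also have "\<dots> = z"
      using k by (simp add: z(2))
    finally have "Q (c / real k)"
      using c(1) z(1) k by (simp add: Q_def)
    then have "real (f c) \<le> real (f (c / real k))"
      using c(2) by (simp only: of_nat_le_iff)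
    moreover have "real (f (c / real k)) * real k = real (f c)"
      using f[OF \<open>Q (c / real k)\<close>] f[OF c(1)] k by simp
    moreover have "real (f c) > 0"
      using f[OF c(1)] c(1) m(2) by (simp add: Q_def)
    ultimately have "real (f c) * real k \<le> real (f c) * 1"
      by (metis mult.right_neutral mult_right_mono of_nat_0_le_iff)
    then have "real k \<le> 1"
      using \<open>real (f c) > 0\<close> by (simp only: mult_le_cancel_left_pos)
    then show "k = 1"
      using k by simp
  qed
  then show ?thesis
    using c(1) that by (auto simp: Q_def)
qed

text \<open>With integer values \<open>p\<close> and \<open>q\<close> at a lattice vector, the
  Bezout combination \<open>z\<close> of the two vectors satisfies \<open>p z = gcd p q * y\<close>.
  Hence both are positive integer multiples of \<open>z\<close>, and primitivity makes both equal to
  \<open>z\<close>.\<close>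

lemma primitive_vector_unique:
  assumes y: "primitive_vector N y" and cy: "primitive_vector N (c *\<^sub>R y)" and "c > 0"
  shows "c *\<^sub>R y = y"
proof -
  have yN: "y \<in> N" "y \<noteq> 0" "c *\<^sub>R y \<in> N"
    and prim: "\<And>z k. z \<in> N \<Longrightarrow> y = of_nat k *\<^sub>R z \<Longrightarrow> k = 1"
      "\<And>z k. z \<in> N \<Longrightarrow> c *\<^sub>R y = of_nat k *\<^sub>R z \<Longrightarrow> k = 1"
    using y cy by (auto simp: primitive_vector_def)
  obtain m where m: "m \<in> M" "y \<bullet> m > 0"
    using lattice_vector_positive yN dual_subset by blast
  obtain p where p: "y \<bullet> m = of_int p"
    using yN(1) m(1) by (auto simp: dual_lattice_def elim: Ints_cases)
  obtain q where q: "(c *\<^sub>R y) \<bullet> m = of_int q"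
    using yN(3) m(1) by (auto simp: dual_lattice_def elim: Ints_cases)
  have "real_of_int p > 0" using p m(2) by simp
  then have p0: "p > 0" by simp
  have cq: "c * of_int p = of_int q" using p q by simp
  moreover have "c * of_int p > 0" using \<open>c > 0\<close> p0 by simp
  ultimately have q0: "q > 0" by simp
  define d where "d = gcd p q"
  have d0: "d > 0" using p0 by (simp add: d_def)
  obtain u w where uw: "u * p + w * q = d"
    using bezout_int[of p q] d_def by blast
  define z where "z = of_int u *\<^sub>R y + of_int w *\<^sub>R (c *\<^sub>R y)"
  have z: "z \<in> N"
    unfolding z_def using yN by (intro dual_add dual_scale)
  obtain p' q' where pq: "p = d * p'" "q = d * q'"
    unfolding d_def by (meson dvdE gcd_dvd1 gcd_dvd2)
  then have pos: "p' > 0" "q' > 0"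
    using p0 q0 d0 by (auto simp: zero_less_mult_iff)
  have "of_int p *\<^sub>R z = (of_int u * of_int p + of_int w * (c * of_int p)) *\<^sub>R y"
    by (simp add: z_def scaleR_add_right scaleR_add_left mult_ac)
  also have "\<dots> = of_int (u * p + w * q) *\<^sub>R y"
    by (simp add: cq)
  finally have pz: "of_int p *\<^sub>R z = of_int d *\<^sub>R y"
    by (simp only: uw)
  then have "of_int d *\<^sub>R (of_int p' *\<^sub>R z) = of_int d *\<^sub>R y"
    by (simp add: pq(1))
  then have y1: "y = of_int p' *\<^sub>R z"
    using d0 by (simp only: scaleR_cancel_left of_int_eq_0_iff) simp
  have "p' = 1"
    using prim(1)[OF z, of "nat p'"] y1 pos by simp
  have "of_int p *\<^sub>R (c *\<^sub>R y) = of_int q *\<^sub>R y"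
    by (simp flip: cq add: mult.commute)
  then have "c *\<^sub>R y = of_int q' *\<^sub>R z"
    using y1 p0 \<open>p' = 1\<close> pq by simp
  then have "q' = 1"
    using prim(2)[OF z, of "nat q'"] pos by simp
  show ?thesis
    using \<open>c *\<^sub>R y = of_int q' *\<^sub>R z\<close> y1 \<open>p' = 1\<close> \<open>q' = 1\<close> by simp
qed

section \<open>Facet normals are well defined\<close>

lemma polytope_P: "polytope P" and polyhedron_P: "polyhedron P" and convex_P: "convex P"
proof -
  obtain S where "finite S" "P = convex hull S"
    using polytope by (auto simp: lattice_polytope_def)
  then show "polytope P" by (auto simp: polytope_def)
  then show "polyhedron P" "convex P"
    by (auto simp: polytope_imp_polyhedron polytope_imp_convex)
qed

lemma P_subset: "P \<subseteq> span M"
  using polytope by (auto simp: lattice_polytope_def) (meson convex_hull_subset_affine_hull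
      affine_hull_subset_span span_mono subset_iff)

lemma affine_hull_P: "affine hull P = span M"
proof -
  have "aff_dim (span M) = int n"
    using dim_span_M by (simp add: aff_dim_subspace)
  then have "affine hull P = affine hull (span M)"
    using aff_dim_eq_full_gen[OF P_subset] full_dim by simp
  then show ?thesis
    by (simp add: subspace_imp_affine hull_same)
qed

text \<open>The directions of a facet span a subspace of dimension \<open>n - 1\<close>, so its
  orthogonal complement inside \<open>span M\<close> is a line, and it contains both
  \<open>a\<close> and \<open>y\<close>.\<close>

lemma constant_on_facet:
  assumes F: "F facet_of P" and a: "a \<in> span M" "a \<noteq> 0" "\<And>x. x \<in> F \<Longrightarrow> a \<bullet> x = b"
    and y: "y \<in> span M" "\<And>x. x \<in> F \<Longrightarrow> y \<bullet> x = b'"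
  obtains c where "y = c *\<^sub>R a"
proof -
  have F': "F \<noteq> {}" "aff_dim F = int n - 1" "F \<subseteq> P"
    using F full_dim by (auto simp: facet_of_def face_of_imp_subset)
  then obtain x0 where x0: "x0 \<in> F" by blast
  define L where "L = span ((+) (- x0) ` F)"
  have "int (dim ((+) (- x0) ` F)) = int n - 1"
    using aff_dim_eq_dim[of x0 F] F' x0 by (simp add: hull_inc)
  then have dimL: "int (dim L) = int n - 1"
    by (simp add: L_def)
  have Lsub: "L \<subseteq> span M"
    unfolding L_def using F' P_subset x0
    by (intro span_minimal) (auto intro!: span_diff simp: subset_iff)
  define O' where "O' = {w \<in> span M. \<forall>x\<in>L. orthogonal x w}"
  have "dim O' + dim L = dim (span M)"
    unfolding O'_def by (rule dim_subspace_orthogonal_to_vectors) (use Lsub in \<open>auto simp: L_def\<close>)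
  then have dimO: "dim O' = 1"
    using dimL dim_span_M by linarith
  have "w \<in> O'" if w: "w \<in> span M" "\<And>x. x \<in> F \<Longrightarrow> w \<bullet> x = \<beta>" for w \<beta>
  proof -
    have "orthogonal w x" if "x \<in> (+) (- x0) ` F" for x
      using that w(2) x0 by (auto simp: orthogonal_def inner_diff_right)
    then have "orthogonal w x" if "x \<in> L" for x
      using that orthogonal_to_span[of x "(+) (- x0) ` F" w] unfolding L_def by simp
    then show ?thesis
      using w(1) by (auto simp: O'_def orthogonal_commute)
  qed
  then have aO: "a \<in> O'" and yO: "y \<in> O'"
    using a y by blast+
  have "subspace O'"
    unfolding O'_def by (auto simp: subspace_def span_zero span_add span_scale orthogonal_def inner_add_right)
  moreover have "span {a} \<subseteq> O'"
    using aO \<open>subspace O'\<close> by (simp add: span_minimal)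
  moreover have "dim (span {a}) = 1"
    using a(2) by (simp add: dim_eq_card_independent)
  ultimately have "span {a} = O'"
    using dimO by (intro subspace_dim_equal) auto
  with yO show ?thesis
    using that by (auto simp: span_singleton)
qed

text \<open>This shows that the description in \<open>facet_normal\<close> denotes. Existence: a
  rational normal of the lattice points of the facet is proportional to \<open>a\<close> and can be
  scaled to an outward primitive vector. Uniqueness: any competitor is a positive multiple of
  it.\<close>

lemma facet_normal_positive_multiple:
  assumes F: "F facet_of P" and a: "a \<in> span M" "\<And>x. x \<in> P \<Longrightarrow> a \<bullet> x \<le> b" "F = P \<inter> {x. a \<bullet> x = b}"
  obtains c where "c > 0" "facet_normal M P F = c *\<^sub>R a" "facet_normal M P F \<in> N"
proof -
  have F': "F \<noteq> {}" "F face_of P" "F \<noteq> P"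
    using F full_dim by (auto simp: facet_of_def)
  then obtain x0 p where x0: "x0 \<in> F" and p: "p \<in> P" "p \<notin> F"
    using face_of_imp_subset by blast
  have ap: "a \<bullet> p < a \<bullet> x0"
    using p x0 a(2)[of p] a(3) by auto
  then have "a \<noteq> 0" by auto
  obtain y where y: "y \<in> N" "y \<noteq> 0" "\<And>d. d \<in> M \<Longrightarrow> a \<bullet> d = 0 \<Longrightarrow> y \<bullet> d = 0"
    using dual_vector_annihilating[OF a(1) \<open>a \<noteq> 0\<close>] by blast
  obtain S where S: "finite S" "S \<subseteq> M" "P = convex hull S"
    using polytope by (auto simp: lattice_polytope_def)
  obtain S' where S': "S' \<subseteq> S" "F = convex hull S'"
    using face_of_convex_hull_subset[OF finite_imp_compact[OF S(1)]] F'(2) S(3) by blast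
  then obtain s where s: "s \<in> S'" using F'(1) by auto
  \<comment> \<open>Elements of \<open>S'\<close> are lattice points on the facet, so their
    differences are lattice vectors orthogonal to \<open>a\<close>, which \<open>y\<close>
    annihilates too.\<close>
  have "S' \<subseteq> {x. y \<bullet> x = y \<bullet> s}"
  proof
    fix x assume x: "x \<in> S'"
    have "x \<in> F" "s \<in> F" using x s S'(2) by (auto simp: hull_inc)
    then have "a \<bullet> (x - s) = 0" by (simp add: a(3) inner_diff_right)
    moreover have "x - s \<in> M" using x s S' S lattice_diff by blast
    ultimately show "x \<in> {x. y \<bullet> x = y \<bullet> s}" using y(3) by (force simp: inner_diff_right)
  qed
  then have "F \<subseteq> {x. y \<bullet> x = y \<bullet> s}"
    unfolding S'(2) by (rule hull_minimal) (rule convex_hyperplane)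
  then obtain c where c: "y = c *\<^sub>R a"
    using constant_on_facet[OF F a(1) \<open>a \<noteq> 0\<close>, of b y "y \<bullet> s"] y(1) dual_subset a(3) by blast
  then have "c \<noteq> 0" using y(2) by auto
  \<comment> \<open>The sign turns \<open>y\<close> outward: \<open>y'\<close> is a positive
    multiple of \<open>a\<close>.\<close>
  define y' where "y' = sgn c *\<^sub>R y"
  have y': "y' \<in> N" "y' \<noteq> 0"
    using y dual_minus \<open>c \<noteq> 0\<close> by (auto simp: y'_def sgn_if)
  have y'a: "y' = \<bar>c\<bar> *\<^sub>R a"
    by (simp add: y'_def c sgn_if abs_if)
  obtain d where d: "d > 0" "primitive_vector N (d *\<^sub>R y')"
    using primitive_multiple_exists[OF y'] by blast
  define e where "e = d * \<bar>c\<bar>"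
  have e: "e > 0" "primitive_vector N (e *\<^sub>R a)"
    using d \<open>c \<noteq> 0\<close> by (simp_all add: e_def y'a)
  have "facet_normal M P F = e *\<^sub>R a"
    unfolding facet_normal_def
  proof (rule the_equality)
    show "primitive_vector N (e *\<^sub>R a) \<and> (\<exists>b. (\<forall>x\<in>P. e *\<^sub>R a \<bullet> x \<le> b) \<and> F = P \<inter> {x. e *\<^sub>R a \<bullet> x = b})"
      using e a by (auto intro!: exI[of _ "e * b"])
    fix w
    assume w: "primitive_vector N w \<and> (\<exists>b. (\<forall>x\<in>P. w \<bullet> x \<le> b) \<and> F = P \<inter> {x. w \<bullet> x = b})"
    then obtain b' where b': "\<And>x. x \<in> P \<Longrightarrow> w \<bullet> x \<le> b'" "F = P \<inter> {x. w \<bullet> x = b'}" by blast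
    have wN: "w \<in> N" "w \<noteq> 0" using w by (auto simp: primitive_vector_def)
    obtain k where k: "w = k *\<^sub>R a"
      using constant_on_facet[OF F a(1) \<open>a \<noteq> 0\<close>, of b w b'] wN(1) dual_subset a(3) b'(2) by blast
    \<comment> \<open>A point \<open>p\<close> of \<open>P\<close> off the facet excludes a negative
      factor: \<open>a\<close> is strictly larger at \<open>x0\<close> than at \<open>p\<close>, and
      \<open>w\<close> is not smaller.\<close>
    have "w \<bullet> p \<le> w \<bullet> x0"
      using b' p x0 by auto
    then have "k * (a \<bullet> x0 - a \<bullet> p) \<ge> 0"
      by (simp add: k right_diff_distrib)
    then have "k > 0"
      using ap k wN(2) by (simp add: zero_le_mult_iff)
    then have "w = (k / e) *\<^sub>R (e *\<^sub>R a)" "k / e > 0"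
      using e k by simp_all
    then show "w = e *\<^sub>R a"
      using primitive_vector_unique[OF e(2), of "k / e"] w by simp
  qed
  moreover have "e *\<^sub>R a \<in> N"
    using e(2) by (simp add: primitive_vector_def)
  ultimately show ?thesis
    using e that by metis
qed

lemma facet_supporting_vector:
  assumes F: "F facet_of P"
  obtains a b where "a \<in> span M" "\<And>x. x \<in> P \<Longrightarrow> a \<bullet> x \<le> b" "F = P \<inter> {x. a \<bullet> x = b}"
proof -
  have "F exposed_face_of P"
    using F polyhedron_P by (simp add: exposed_face_of_polyhedron facet_of_imp_face_of)
  then obtain a b where ab: "P \<subseteq> {x. a \<bullet> x \<le> b}" "F = P \<inter> {x. a \<bullet> x = b}"
    by (auto simp: exposed_face_of_def)
  obtain y z where yz: "y \<in> span M" "\<And>w. w \<in> span M \<Longrightarrow> orthogonal z w" "a = y + z"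
    using orthogonal_subspace_decomp_exists[of M a] by metis
  have "y \<bullet> x = a \<bullet> x" if "x \<in> P" for x
    using yz(2)[of x] that P_subset by (auto simp: yz(3) orthogonal_def inner_add_left)
  with ab yz(1) show ?thesis
    by (intro that[of y b]) auto
qed

lemma facet_normal_in_dual: "F facet_of P \<Longrightarrow> facet_normal M P F \<in> N"
  by (metis facet_supporting_vector facet_normal_positive_multiple)

text \<open>A vector \<open>w\<close> orthogonal to all normals at \<open>v\<close> would let
  \<open>v\<close> move a little both ways along \<open>w\<close> inside \<open>P\<close>:
  constraints tight at \<open>v\<close> do not change, the finitely many others have slack. Then
  \<open>v\<close> would not be extreme.\<close>

lemma span_facet_normals_at_vertex:
  assumes v: "v extreme_point_of P"
  shows "span (facet_normal M P ` {F. F facet_of P \<and> v \<in> F}) = span M"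
proof (rule ccontr)
  let ?S = "facet_normal M P ` {F. F facet_of P \<and> v \<in> F}"
  assume "span ?S \<noteq> span M"
  moreover have "span ?S \<subseteq> span M"
    using facet_normal_in_dual dual_subset by (intro span_minimal) auto
  ultimately have "span ?S \<subset> span M" by blast
  then obtain w where w: "w \<noteq> 0" "w \<in> span M" "\<And>y. y \<in> span ?S \<Longrightarrow> orthogonal w y"
    using orthogonal_to_subspace_exists_gen by blast
  \<comment> \<open>In a minimal representation each halfspace cuts out a facet. The normals are
    parallel to the affine hull, which is \<open>span M\<close> and contains 0, so they lie in
    \<open>span M\<close>.\<close>
  obtain H where H: "finite H" "P = affine hull P \<inter> \<Inter>H"
    "\<forall>h\<in>H. \<exists>a b. a \<noteq> 0 \<and> h = {x. a \<bullet> x \<le> b} \<and> (\<forall>x\<in>affine hull P. x + a \<in> affine hull P)"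
    "\<forall>H'. H' \<subset> H \<longrightarrow> P \<subset> affine hull P \<inter> \<Inter>H'"
    using polyhedron_P unfolding polyhedron_Int_affine_parallel_minimal by blast
  obtain a b where ab: "\<And>h. h \<in> H \<Longrightarrow> a h \<noteq> 0 \<and> h = {x. a h \<bullet> x \<le> b h} \<and> (\<forall>x\<in>affine hull P. x + a h \<in> affine hull P)"
    using H(3) by metis
  have aM: "a h \<in> span M" if "h \<in> H" for h
    using ab[OF that] affine_hull_P span_zero by (metis add_0)
  have P_iff: "x \<in> P \<longleftrightarrow> x \<in> span M \<and> (\<forall>h\<in>H. a h \<bullet> x \<le> b h)" for x
    using H(2) ab unfolding affine_hull_P by blast
  have vP: "v \<in> P" using v by (simp add: extreme_point_of_def)
  have ortho: "a h \<bullet> w = 0" if h: "h \<in> H" "a h \<bullet> v = b h" for h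
  proof -
    let ?F = "P \<inter> {x. a h \<bullet> x = b h}"
    have "?F facet_of P"
      using facet_of_polyhedron_explicit[OF H(1,2), of a b ?F] ab H(4) h(1) by blast
    moreover obtain c where c: "c > 0" "facet_normal M P ?F = c *\<^sub>R a h"
      using facet_normal_positive_multiple[OF calculation aM[OF h(1)], of "b h"] P_iff h(1) by metis
    ultimately have "orthogonal w (c *\<^sub>R a h)"
      using vP h(2) by (intro w(3) span_base) (auto simp flip: c(2))
    then show ?thesis
      using c(1) by (simp add: orthogonal_def inner_commute)
  qed
  have "\<forall>\<^sub>F \<epsilon> in at_right (0::real). a h \<bullet> (v + \<epsilon> *\<^sub>R w) \<le> b h \<and> a h \<bullet> (v - \<epsilon> *\<^sub>R w) \<le> b h" if h: "h \<in> H" for h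
  proof (cases "a h \<bullet> v = b h")
    case True
    then show ?thesis
      using ortho[OF h] by (simp add: inner_add_right inner_diff_right)
  next
    case False
    then have lt: "a h \<bullet> v < b h" using P_iff vP h by force
    have "((\<lambda>\<epsilon>. a h \<bullet> (v + \<epsilon> *\<^sub>R w)) \<longlongrightarrow> a h \<bullet> (v + 0 *\<^sub>R w)) (at_right 0)"
      "((\<lambda>\<epsilon>. a h \<bullet> (v - \<epsilon> *\<^sub>R w)) \<longlongrightarrow> a h \<bullet> (v - 0 *\<^sub>R w)) (at_right 0)"
      by (intro tendsto_intros)+
    then have "\<forall>\<^sub>F \<epsilon> in at_right (0::real). a h \<bullet> (v + \<epsilon> *\<^sub>R w) < b h"
      "\<forall>\<^sub>F \<epsilon> in at_right (0::real). a h \<bullet> (v - \<epsilon> *\<^sub>R w) < b h"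
      using lt order_tendstoD(2) by fastforce+
    then show ?thesis
      by eventually_elim auto
  qed
  then have "\<forall>\<^sub>F \<epsilon> in at_right (0::real). \<forall>h\<in>H. a h \<bullet> (v + \<epsilon> *\<^sub>R w) \<le> b h \<and> a h \<bullet> (v - \<epsilon> *\<^sub>R w) \<le> b h"
    using H(1) by (intro eventually_ball_finite) auto
  then have "\<forall>\<^sub>F \<epsilon> in at_right (0::real). 0 < \<epsilon> \<and> (\<forall>h\<in>H. a h \<bullet> (v + \<epsilon> *\<^sub>R w) \<le> b h \<and> a h \<bullet> (v - \<epsilon> *\<^sub>R w) \<le> b h)"
    using eventually_at_right_less[of 0] by eventually_elim auto
  from eventually_happens'[OF trivial_limit_at_right_real this]
  obtain \<epsilon> where \<epsilon>: "\<epsilon> > 0" "\<forall>h\<in>H. a h \<bullet> (v + \<epsilon> *\<^sub>R w) \<le> b h \<and> a h \<bullet> (v - \<epsilon> *\<^sub>R w) \<le> b h"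
    by blast
  have "v + \<epsilon> *\<^sub>R w \<in> P" "v - \<epsilon> *\<^sub>R w \<in> P"
    unfolding P_iff using \<epsilon>(2) vP P_subset w(2) by (auto intro!: span_add span_diff span_scale)
  moreover have "v \<in> open_segment (v + \<epsilon> *\<^sub>R w) (v - \<epsilon> *\<^sub>R w)"
  proof -
    have "v + \<epsilon> *\<^sub>R w \<noteq> v - \<epsilon> *\<^sub>R w"
    proof
      assume "v + \<epsilon> *\<^sub>R w = v - \<epsilon> *\<^sub>R w"
      then have "(2 * \<epsilon>) *\<^sub>R w = 0" by (simp add: algebra_simps flip: scaleR_add_left)
      then show False using \<epsilon>(1) w(1) by simp
    qed
    moreover have "v = midpoint (v + \<epsilon> *\<^sub>R w) (v - \<epsilon> *\<^sub>R w)"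
      by (simp add: midpoint_def flip: scaleR_2)
    ultimately show ?thesis
      by (metis midpoint_in_open_segment)
  qed
  ultimately show False
    using v by (auto simp: extreme_point_of_def)
qed

text \<open>In other words, the subtorus over a vertex is the whole torus.\<close>

lemma span_normal_sublattice_vertex:
  assumes "v extreme_point_of P"
  shows "span (normal_sublattice M P {v}) = span N"
proof -
  let ?S = "facet_normal M P ` {F. F facet_of P \<and> v \<in> F}"
  have "span (normal_sublattice M P {v}) = span M"
    using span_facet_normals_at_vertex[OF assms] by (simp add: normal_sublattice_def span_int_span)
  moreover have "span N \<subseteq> span M"
    using dual_subset by (simp add: span_minimal)
  moreover have "span M \<subseteq> span N"
    using span_facet_normals_at_vertex[OF assms] span_mono[of ?S N] facet_normal_in_dual by auto
  ultimately show ?thesis by blast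
qed

end

subsection \<open>The quotient model\<close>

lemma topspace_quotient_topology: "topspace (quotient_topology X f) = f ` topspace X"
  using quotient_map_quotient_topology quotient_imp_surjective_map by metis

context lattice_full_polytope
begin

section \<open>The torus as a quotient group\<close>

abbreviation cls :: "'a \<Rightarrow> 'a set" where "cls \<equiv> torus_class N"
abbreviation torus :: "'a set set" where "torus \<equiv> cls ` span N"

lemma cls_eq: "cls u = (\<lambda>h. h + u) ` N"
  by (auto simp: torus_class_def r_coset_def additive_group_def)

lemma cls_eq_iff: "cls u = cls w \<longleftrightarrow> w - u \<in> N"
proof
  assume "cls u = cls w"
  then have "w \<in> cls u"
    using dual_0 by (auto simp: cls_eq)
  then show "w - u \<in> N"
    by (auto simp: cls_eq)
next
  assume wu: "w - u \<in> N"
  have "h + u \<in> cls w" "h + w \<in> cls u" if "h \<in> N" for h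
  proof -
    have "h + u = (h + - (w - u)) + w" "h + w = (h + (w - u)) + u"
      by simp_all
    moreover have "h + - (w - u) \<in> N" "h + (w - u) \<in> N"
      by (rule dual_add[OF that dual_minus[OF wu]], rule dual_add[OF that wu])
    ultimately show "h + u \<in> cls w" "h + w \<in> cls u"
      unfolding cls_eq by (metis image_eqI)+
  qed
  then show "cls u = cls w"
    unfolding cls_eq[of u] cls_eq[of w] by (auto simp: cls_eq)
qed

lemma comm_group_additive_span: "comm_group (additive_group (span N))"
  by (rule comm_groupI)
    (auto simp: additive_group_def span_add span_zero intro: bexI[of _ "- x" for x] span_neg)

lemma normal_dual: "N \<lhd> additive_group (span N)"
proof -
  interpret comm_group "additive_group (span N)"
    by (rule comm_group_additive_span)
  have "inv\<^bsub>additive_group (span N)\<^esub> x = - x" if "x \<in> N" for x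
    by (rule inv_equality) (use that in \<open>auto simp: additive_group_def intro: span_base span_neg\<close>)
  then have "subgroup N (additive_group (span N))"
    using dual_0 by (intro subgroupI) (auto simp: additive_group_def dual_add dual_minus intro: span_base)
  then show ?thesis
    by (simp add: normal_iff_subgroup)
qed

lemma carrier_torus_group: "carrier (torus_group N) = torus"
  by (simp add: torus_group_def carrier_FactGroup torus_class_def additive_group_def)

lemma mult_torus_group:
  assumes "u \<in> span N" "w \<in> span N"
  shows "cls u \<otimes>\<^bsub>torus_group N\<^esub> cls w = cls (u + w)"
  using normal.rcos_sum[OF normal_dual, of u w] assms
  by (simp add: torus_group_def torus_class_def additive_group_def)

lemma inv_torus_group:
  assumes "u \<in> span N"
  shows "inv\<^bsub>torus_group N\<^esub> cls u = cls (- u)"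
proof -
  interpret group "torus_group N"
    unfolding torus_group_def by (rule normal.factorgroup_is_group[OF normal_dual])
  have "\<one>\<^bsub>torus_group N\<^esub> = cls 0"
    by (simp add: torus_group_def cls_eq)
  then have "cls (- u) \<otimes>\<^bsub>torus_group N\<^esub> cls u = \<one>\<^bsub>torus_group N\<^esub>"
    using mult_torus_group[of "- u" u] assms by (simp add: span_neg)
  then show ?thesis
    using assms by (intro inv_equality) (auto simp: carrier_torus_group span_neg)
qed

section \<open>Minimal faces and stabilizers\<close>

text \<open>The intersection of all faces through \<open>p\<close> works: were \<open>p\<close> on
  its relative boundary, a facet of it would be a smaller face through \<open>p\<close>.\<close>

lemma minimal_face_exists:
  assumes "p \<in> P"
  obtains E where "E face_of P" "p \<in> rel_interior E"
proof -
  define E where "E = \<Inter>{F. F face_of P \<and> p \<in> F}"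
  have E: "E face_of P"
    unfolding E_def using assms convex_P face_of_refl by (intro face_of_Inter) auto
  have "p \<in> E" by (auto simp: E_def)
  have "polyhedron E"
    using E polyhedron_P face_of_polyhedron_polyhedron by blast
  have "p \<in> rel_interior E"
  proof (rule ccontr)
    assume "p \<notin> rel_interior E"
    then obtain F where F: "F facet_of E" "p \<in> F"
      using rel_boundary_of_polyhedron[OF \<open>polyhedron E\<close>] \<open>p \<in> E\<close> by blast
    then have "F face_of P"
      using E face_of_trans facet_of_imp_face_of by blast
    then have "E \<subseteq> F"
      using F(2) by (auto simp: E_def)
    then have "E = F"
      using F(1) facet_of_imp_subset by blast
    then show False
      using F(1) facet_of_irrefl by blast
  qed
  with E that show ?thesis by blast
qed

definition mface :: "'a \<Rightarrow> 'a set" where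
  "mface p = (SOME E. E face_of P \<and> p \<in> rel_interior E)"

lemma mface:
  assumes "p \<in> P"
  shows "mface p face_of P" "p \<in> rel_interior (mface p)" "p \<in> mface p"
proof -
  have "\<exists>E. E face_of P \<and> p \<in> rel_interior E"
    using minimal_face_exists[OF assms] by blast
  from someI_ex[OF this] show "mface p face_of P" "p \<in> rel_interior (mface p)"
    by (simp_all add: mface_def)
  then show "p \<in> mface p"
    using rel_interior_subset by blast
qed

lemma mface_unique: "E face_of P \<Longrightarrow> p \<in> rel_interior E \<Longrightarrow> p \<in> P \<Longrightarrow> E = mface p"
  using face_of_eq[of E P "mface p"] mface by blast

lemma mface_minimal:
  assumes "p \<in> P" "F face_of P" "p \<in> F"
  shows "mface p \<subseteq> F"
  using subset_of_face_of[OF assms(2), of "mface p"] mface[OF assms(1)] assms(3) face_of_imp_subset by blast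

text \<open>The preimage under \<open>cls\<close> of the subtorus collapsed over \<open>p\<close>.
  It turns the quotient relation into congruence of vectors modulo an additive subgroup.\<close>

definition stab :: "'a \<Rightarrow> 'a set" where
  "stab p = {l + m | l m. l \<in> span (normal_sublattice M P (mface p)) \<and> m \<in> N}"

lemma stab_0: "0 \<in> stab p"
  unfolding stab_def using span_zero dual_0 by force

lemma stab_minus:
  assumes "x \<in> stab p"
  shows "- x \<in> stab p"
proof -
  from assms obtain l m where "x = l + m" "l \<in> span (normal_sublattice M P (mface p))" "m \<in> N"
    unfolding stab_def by blast
  then have "- x = - l + - m" "- l \<in> span (normal_sublattice M P (mface p))" "- m \<in> N"
    by (auto simp: span_neg dual_minus)
  then show ?thesis
    unfolding stab_def by blast
qed

lemma stab_add:
  assumes "x \<in> stab p" "y \<in> stab p"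
  shows "x + y \<in> stab p"
proof -
  from assms obtain l m l' m' where "x = l + m" "l \<in> span (normal_sublattice M P (mface p))" "m \<in> N"
    "y = l' + m'" "l' \<in> span (normal_sublattice M P (mface p))" "m' \<in> N"
    unfolding stab_def by blast
  then have "x + y = (l + l') + (m + m')" "l + l' \<in> span (normal_sublattice M P (mface p))" "m + m' \<in> N"
    by (auto simp: span_add dual_add)
  then show ?thesis
    unfolding stab_def by blast
qed

text \<open>A point of the minimal face of \<open>p\<close> has a smaller minimal face, which lies
  in more facets and so contributes more normals.\<close>

lemma stab_mono:
  assumes "p \<in> P" "q \<in> mface p"
  shows "stab p \<subseteq> stab q"
proof -
  have "q \<in> P"
    using assms mface(1) face_of_imp_subset by blast
  then have "mface q \<subseteq> mface p"
    using assms mface by (intro mface_minimal) auto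
  then have "facet_normal M P ` {F. F facet_of P \<and> mface p \<subseteq> F} \<subseteq> facet_normal M P ` {F. F facet_of P \<and> mface q \<subseteq> F}"
    by auto
  then have "span (normal_sublattice M P (mface p)) \<subseteq> span (normal_sublattice M P (mface q))"
    unfolding normal_sublattice_def span_int_span by (rule span_mono)
  then show ?thesis
    unfolding stab_def by blast
qed

lemma subtorus_iff:
  "cls x \<in> subtorus M P (mface p) \<longleftrightarrow> x \<in> stab p"
proof
  assume "cls x \<in> subtorus M P (mface p)"
  then obtain l where l: "l \<in> span (normal_sublattice M P (mface p))" "cls l = cls x"
    by (auto simp: subtorus_def)
  then have "x = l + (x - l)" "x - l \<in> N"
    by (simp_all add: cls_eq_iff)
  then show "x \<in> stab p"
    using l(1) unfolding stab_def by blast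
next
  assume "x \<in> stab p"
  then obtain l m where "x = l + m" "l \<in> span (normal_sublattice M P (mface p))" "m \<in> N"
    unfolding stab_def by blast
  moreover from this have "cls l = cls x"
    by (simp add: cls_eq_iff)
  ultimately show "cls x \<in> subtorus M P (mface p)"
    unfolding subtorus_def by (metis image_eqI)
qed

section \<open>The equivalence relation and its projection\<close>

lemma toric_rel_iff:
  assumes "u \<in> span N" "w \<in> span N"
  shows "((p, cls u), (q, cls w)) \<in> toric_rel M P \<longleftrightarrow> p \<in> P \<and> q = p \<and> w - u \<in> stab p"
proof -
  have eq: "inv\<^bsub>torus_group N\<^esub> cls u \<otimes>\<^bsub>torus_group N\<^esub> cls w = cls (w - u)"
    using assms by (simp add: inv_torus_group mult_torus_group span_neg)
  have "(\<exists>E. E face_of P \<and> p \<in> rel_interior E \<and> cls (w - u) \<in> subtorus M P E) \<longleftrightarrow> w - u \<in> stab p"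
    if "p \<in> P"
    using mface(1,2)[OF that] mface_unique[OF _ _ that] subtorus_iff by metis
  then show ?thesis
    using assms by (auto simp: toric_rel_def eq carrier_torus_group)
qed

lemma toric_rel_subset: "toric_rel M P \<subseteq> (P \<times> torus) \<times> (P \<times> torus)"
  by (auto simp: toric_rel_def carrier_torus_group)

lemma equiv_toric_rel: "equiv (P \<times> torus) (toric_rel M P)"
proof (rule equivI)
  show "toric_rel M P \<subseteq> (P \<times> torus) \<times> (P \<times> torus)"
    by (rule toric_rel_subset)
  show "refl_on (P \<times> torus) (toric_rel M P)"
    by (rule refl_onI) (auto simp: toric_rel_iff stab_0)
  show "sym (toric_rel M P)"
  proof (rule symI)
    fix x y
    assume xy: "(x, y) \<in> toric_rel M P"
    then obtain p u q w where [simp]: "x = (p, cls u)" "y = (q, cls w)" and uw: "u \<in> span N" "w \<in> span N"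
      using toric_rel_subset by blast
    have "p \<in> P" "q = p" "w - u \<in> stab p"
      using xy uw by (auto simp: toric_rel_iff)
    then show "(y, x) \<in> toric_rel M P"
      using uw stab_minus[of "w - u" p] by (simp add: toric_rel_iff)
  qed
  show "trans (toric_rel M P)"
  proof (rule transI)
    fix x y z
    assume xy: "(x, y) \<in> toric_rel M P" and yz: "(y, z) \<in> toric_rel M P"
    then obtain p u q w r t where [simp]: "x = (p, cls u)" "y = (q, cls w)" "z = (r, cls t)"
      and uw: "u \<in> span N" "w \<in> span N" "t \<in> span N"
      using toric_rel_subset by blast
    have "p \<in> P" "q = p" "r = p" "w - u \<in> stab p" "t - w \<in> stab p"
      using xy yz uw by (auto simp: toric_rel_iff)
    then show "(x, z) \<in> toric_rel M P"
      using uw stab_add[of "w - u" p "t - w"] by (simp add: toric_rel_iff)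
  qed
qed

abbreviation proj :: "'a \<times> 'a set \<Rightarrow> ('a \<times> 'a set) set" where
  "proj x \<equiv> toric_rel M P `` {x}"

lemma proj_eq_iff:
  assumes "p \<in> P" "u \<in> span N" "q \<in> P" "w \<in> span N"
  shows "proj (p, cls u) = proj (q, cls w) \<longleftrightarrow> q = p \<and> w - u \<in> stab p"
  using eq_equiv_class_iff[OF equiv_toric_rel, of "(p, cls u)" "(q, cls w)"] assms by (simp add: toric_rel_iff)

lemma orbit_map_proj:
  assumes "p \<in> P" "t \<in> torus"
  shows "orbit_map (proj (p, t)) = p"
proof -
  have "(p, t) \<in> proj (p, t)"
    using assms equiv_toric_rel by (auto simp: equiv_def refl_on_def)
  moreover have "fst x = p" if "x \<in> proj (p, t)" for x
    using that by (auto simp: toric_rel_def)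
  ultimately have "fst ` proj (p, t) = {p}"
    by force
  then show ?thesis
    by (simp add: orbit_map_def)
qed

abbreviation T :: "'a set topology" where "T \<equiv> torus_space N"

lemma topspace_torus_space: "topspace T = torus"
  by (simp add: torus_space_def topspace_quotient_topology)

lemma quotient_map_proj: "quotient_map (prod_topology (top_of_set P) T) (toric_variety M P) proj"
  unfolding toric_variety_def by (rule quotient_map_quotient_topology)

lemma topspace_toric_variety: "topspace (toric_variety M P) = proj ` (P \<times> torus)"
  by (simp add: toric_variety_def topspace_quotient_topology topspace_torus_space)

lemma orbit_map_in: "c \<in> topspace (toric_variety M P) \<Longrightarrow> orbit_map c \<in> P"
  using orbit_map_proj by (auto simp: topspace_toric_variety)

lemma continuous_orbit_map: "continuous_map (toric_variety M P) (top_of_set P) orbit_map"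
proof (rule continuous_compose_quotient_map[OF quotient_map_proj])
  show "continuous_map (prod_topology (top_of_set P) T) (top_of_set P) (orbit_map \<circ> proj)"
    by (rule continuous_map_eq[OF continuous_map_fst])
      (auto simp: topspace_torus_space orbit_map_proj)
qed

section \<open>Preimages under the orbit map and lifted homotopies\<close>

definition fib :: "'a set \<Rightarrow> ('a \<times> 'a set) set set" where
  "fib A = {c \<in> topspace (toric_variety M P). orbit_map c \<in> A}"

lemma orbit_preimage_eq: "orbit_preimage M P A = subtopology (toric_variety M P) (fib A)"
  by (simp add: orbit_preimage_def fib_def)

lemma openin_fib: "openin (top_of_set P) A \<Longrightarrow> openin (toric_variety M P) (fib A)"
  unfolding fib_def by (rule openin_continuous_map_preimage[OF continuous_orbit_map])

lemma closedin_fib: "closedin (top_of_set P) A \<Longrightarrow> closedin (toric_variety M P) (fib A)"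
  unfolding fib_def by (rule closedin_continuous_map_preimage[OF continuous_orbit_map])

lemma topspace_orbit_preimage: "topspace (orbit_preimage M P A) = fib A"
  by (auto simp: orbit_preimage_eq fib_def)

lemma fib_eq: "A \<subseteq> P \<Longrightarrow> fib A = proj ` (A \<times> torus)"
  by (auto simp: fib_def topspace_toric_variety orbit_map_proj subset_iff)

lemma proj_in_fib_iff:
  assumes "p \<in> P" "t \<in> torus"
  shows "proj (p, t) \<in> fib A \<longleftrightarrow> p \<in> A"
  unfolding fib_def topspace_toric_variety using assms orbit_map_proj[OF assms] by auto

text \<open>A quotient map restricts to closed and to open saturated sets, though not to arbitrary
  subsets. Applying both restrictions in turn covers closed sets with a vertex removed, on which the
  radial homotopies live.\<close>

lemma quotient_map_proj_locally_closed:
  assumes C: "closedin (top_of_set P) C" and O: "openin (top_of_set P) O'"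
  shows "quotient_map (prod_topology (top_of_set (C \<inter> O')) T) (orbit_preimage M P (C \<inter> O')) proj"
proof -
  let ?X = "prod_topology (top_of_set P) T"
  have sub: "C \<subseteq> P" "O' \<subseteq> P"
    using C O by (auto dest: closedin_imp_subset openin_imp_subset)
  have pre: "{x \<in> topspace (prod_topology (top_of_set S) T). proj x \<in> fib A} = (S \<inter> A) \<times> torus" if "S \<subseteq> P" for S A
    using that proj_in_fib_iff by (auto simp: topspace_torus_space)
  have 1: "quotient_map (subtopology ?X (C \<times> torus)) (subtopology (toric_variety M P) (fib C)) proj"
    using pre[of P C] sub closedin_fib[OF C]
    by (intro quotient_map_restriction[OF quotient_map_proj]) (simp_all add: Int_absorb1)
  have eq: "subtopology ?X (C \<times> torus) = prod_topology (top_of_set C) T"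
    using sub by (simp add: subtopology_Times subtopology_subtopology Int_absorb1 flip: topspace_torus_space)
  have 2: "quotient_map (subtopology (prod_topology (top_of_set C) T) ((C \<inter> O') \<times> torus))
      (subtopology (subtopology (toric_variety M P) (fib C)) (fib C \<inter> fib O')) proj"
  proof (rule quotient_map_restriction[OF 1[unfolded eq]])
    show "{x \<in> topspace (prod_topology (top_of_set C) T). proj x \<in> fib C \<inter> fib O'} = (C \<inter> O') \<times> torus"
      using pre[OF sub(1), of C] pre[OF sub(1), of O'] by auto
    show "openin (subtopology (toric_variety M P) (fib C)) (fib C \<inter> fib O')
      \<or> closedin (subtopology (toric_variety M P) (fib C)) (fib C \<inter> fib O')"
      using openin_fib[OF O] by (auto simp: openin_subtopology_Int2)
  qed
  have "fib C \<inter> fib O' = fib (C \<inter> O')" "fib C \<inter> fib (C \<inter> O') = fib (C \<inter> O')"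
    by (auto simp: fib_def)
  moreover have "subtopology (prod_topology (top_of_set C) T) ((C \<inter> O') \<times> torus) = prod_topology (top_of_set (C \<inter> O')) T"
    by (simp add: subtopology_Times subtopology_subtopology Int_absorb1 flip: topspace_torus_space)
  ultimately show ?thesis
    using 2 by (simp add: orbit_preimage_eq subtopology_subtopology)
qed

text \<open>A homotopy of a subset of \<open>P\<close> that never leaves a face shrinks the minimal face of every point,
  so it only enlarges the subtori that are collapsed, and hence lifts to the quotient.\<close>

lemma homotopy_lift:
  assumes C: "closedin (top_of_set P) C" and O: "openin (top_of_set P) O'" and A: "A = C \<inter> O'"
    and h: "continuous_on ({0..1} \<times> A) h" and hP: "\<And>s p. s \<in> {0..1} \<Longrightarrow> p \<in> A \<Longrightarrow> h (s, p) \<in> P"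
    and face: "\<And>s p F. s \<in> {0..1::real} \<Longrightarrow> p \<in> A \<Longrightarrow> F face_of P \<Longrightarrow> p \<in> F \<Longrightarrow> h (s, p) \<in> F"
  obtains H where
    "continuous_map (prod_topology (top_of_set {0..1}) (orbit_preimage M P A)) (toric_variety M P) H"
    "\<And>s p t. s \<in> {0..1} \<Longrightarrow> p \<in> A \<Longrightarrow> t \<in> torus \<Longrightarrow> H (s, proj (p, t)) = proj (h (s, p), t)"
proof -
  let ?I = "top_of_set {0..1::real}"
  let ?Z = "prod_topology ?I (prod_topology (top_of_set A) T)"
  have sub: "A \<subseteq> P"
    using C O A by (auto dest: closedin_imp_subset openin_imp_subset)
  \<comment> \<open>The unit interval is locally compact Hausdorff, so multiplying by it preserves
    the quotient map and \<open>H\<close> may be defined on representatives.\<close>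
  have "locally_compact_space ?I" "Hausdorff_space ?I"
    by (simp_all add: compact_imp_locally_compact_space compact_space_subtopology Hausdorff_space_subtopology)
  then have q: "quotient_map ?Z (prod_topology ?I (orbit_preimage M P A)) (\<lambda>(x, y). (x, proj y))"
    using quotient_map_proj_locally_closed[OF C O] unfolding A by (intro quotient_map_prod_right) auto
  define G where "G z = proj (h (fst z, fst (snd z)), snd (snd z))" for z
  have c1: "continuous_map ?Z (top_of_set ({0..1} \<times> A)) (\<lambda>z. (fst z, fst (snd z)))"
    unfolding prod_topology_subtopology_eu[symmetric]
    by (intro continuous_map_pairedI continuous_map_fst continuous_map_fst_of[unfolded o_def] continuous_map_snd
        continuous_map_compose[OF continuous_map_snd continuous_map_fst, unfolded o_def])
  have c2: "continuous_map (top_of_set ({0..1} \<times> A)) (top_of_set P) h"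
    using h hP by (auto simp: continuous_map_in_subtopology)
  have c3: "continuous_map ?Z (prod_topology (top_of_set P) T) (\<lambda>z. (h (fst z, fst (snd z)), snd (snd z)))"
    by (intro continuous_map_pairedI continuous_map_compose[OF c1 c2, unfolded o_def]
        continuous_map_compose[OF continuous_map_snd continuous_map_snd, unfolded o_def])
  have G: "continuous_map ?Z (toric_variety M P) G"
    using continuous_map_compose[OF c3 quotient_imp_continuous_map[OF quotient_map_proj]]
    by (simp add: G_def[abs_def] o_def)
  have fibre: "G x = G y" if xy: "x \<in> topspace ?Z" "y \<in> topspace ?Z" "(\<lambda>(x, y). (x, proj y)) x = (\<lambda>(x, y). (x, proj y)) y" for x y
  proof -
    obtain s p u where x: "x = (s, p, cls u)" "s \<in> {0..1}" "p \<in> A" "u \<in> span N"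
      using xy(1) by (cases x) (auto simp: topspace_torus_space)
    obtain s' p' u' where y: "y = (s', p', cls u')" "s' \<in> {0..1}" "p' \<in> A" "u' \<in> span N"
      using xy(2) by (cases y) (auto simp: topspace_torus_space)
    have "s' = s" "p' = p" "u' - u \<in> stab p"
      using xy(3) x y sub proj_eq_iff[of p u p' u'] by auto
    moreover have "h (s, p) \<in> mface p"
      using face[OF x(2,3)] mface[of p] x(3) sub by blast
    then have "stab p \<subseteq> stab (h (s, p))"
      using stab_mono x(3) sub by blast
    ultimately show ?thesis
      using x y hP[OF x(2,3)] by (auto simp: G_def proj_eq_iff)
  qed
  show thesis
  proof (rule quotient_map_lift_exists[OF q G fibre])
    fix H
    assume H: "continuous_map (prod_topology ?I (orbit_preimage M P A)) (toric_variety M P) H"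
      "\<And>z. z \<in> topspace ?Z \<Longrightarrow> H (case z of (x, y) \<Rightarrow> (x, proj y)) = G z"
    show thesis
    proof (rule that[OF H(1)])
      show "H (s, proj (p, t)) = proj (h (s, p), t)" if "s \<in> {0..1}" "p \<in> A" "t \<in> torus" for s p t
        using H(2)[of "(s, p, t)"] that by (simp add: G_def topspace_torus_space)
    qed
  qed assumption
qed

text \<open>The lifted homotopy joins the identity to a map into the preimage of \<open>A'\<close>,
  so that preimage dominates the one of \<open>A\<close>. The points of \<open>A'\<close> may move
  during the homotopy.\<close>

lemma torsion_homology_face_retract:
  assumes C: "closedin (top_of_set P) C" and O: "openin (top_of_set P) O'" and A: "A = C \<inter> O'"
    and "A' \<subseteq> A"
    and h: "continuous_on ({0..1} \<times> A) h" and hA: "\<And>s p. s \<in> {0..1} \<Longrightarrow> p \<in> A \<Longrightarrow> h (s, p) \<in> A"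
    and h0: "\<And>p. p \<in> A \<Longrightarrow> h (0, p) = p" and h1: "\<And>p. p \<in> A \<Longrightarrow> h (1, p) \<in> A'"
    and face: "\<And>s p F. s \<in> {0..1::real} \<Longrightarrow> p \<in> A \<Longrightarrow> F face_of P \<Longrightarrow> p \<in> F \<Longrightarrow> h (s, p) \<in> F"
    and tors: "torsion_homology d (orbit_preimage M P A')"
  shows "torsion_homology d (orbit_preimage M P A)"
proof -
  have sub: "A \<subseteq> P"
    using C O A by (auto dest: closedin_imp_subset openin_imp_subset)
  have hP: "\<And>s p. s \<in> {0..1} \<Longrightarrow> p \<in> A \<Longrightarrow> h (s, p) \<in> P"
    using hA sub by blast
  obtain H where H: "continuous_map (prod_topology (top_of_set {0..1}) (orbit_preimage M P A)) (toric_variety M P) H"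
    "\<And>s p t. s \<in> {0..1} \<Longrightarrow> p \<in> A \<Longrightarrow> t \<in> torus \<Longrightarrow> H (s, proj (p, t)) = proj (h (s, p), t)"
    using homotopy_lift[OF C O A h hP face] by blast
  have fibE: "\<exists>p\<in>A. \<exists>t\<in>torus. c = proj (p, t)" if "c \<in> fib A" for c
    using that fib_eq[OF sub] by auto
  have HA: "H (s, c) \<in> fib A" if "s \<in> {0..1}" "c \<in> fib A" for s c
    using fibE[OF that(2)] H(2) hA that(1) fib_eq[OF sub] by fastforce
  have "topspace (orbit_preimage M P A) = fib A" "topspace (orbit_preimage M P A') = fib A'"
    by (rule topspace_orbit_preimage)+
  note tops = this
  have cH: "continuous_map (prod_topology (top_of_set {0..1}) (orbit_preimage M P A)) (orbit_preimage M P A) H"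
    unfolding orbit_preimage_eq[of A] using H(1)[unfolded orbit_preimage_eq] HA
    by (intro continuous_map_into_subtopology) (auto simp: fib_def)
  have H1: "H (1, c) \<in> fib A'" if "c \<in> fib A" for c
  proof -
    from fibE[OF that] obtain p t where pt: "p \<in> A" "t \<in> torus" "c = proj (p, t)"
      by blast
    then have "H (1, c) = proj (h (1, p), t)"
      using H(2)[of 1] by simp
    then show ?thesis
      using h1[OF pt(1)] pt(2) fib_eq[of A'] \<open>A' \<subseteq> A\<close> sub by blast
  qed
  have H0: "H (0, c) = c" if "c \<in> fib A" for c
    using fibE[OF that] H(2)[of 0] h0 by auto
  have "continuous_map (orbit_preimage M P A) (prod_topology (top_of_set {0..1::real}) (orbit_preimage M P A)) (\<lambda>c. (1, c))"
    by (intro continuous_map_pairedI) (auto simp: continuous_map_const)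
  from continuous_map_compose[OF this cH]
  have cH1: "continuous_map (orbit_preimage M P A) (orbit_preimage M P A) (\<lambda>c. H (1, c))"
    by (simp add: o_def)
  then have f: "continuous_map (orbit_preimage M P A) (orbit_preimage M P A') (\<lambda>c. H (1, c))"
    using H1 by (auto simp: orbit_preimage_eq continuous_map_in_subtopology fib_def)
  have "fib A' \<subseteq> fib A"
    using \<open>A' \<subseteq> A\<close> by (auto simp: fib_def)
  then have g: "continuous_map (orbit_preimage M P A') (orbit_preimage M P A) id"
    by (auto simp: orbit_preimage_eq continuous_map_in_subtopology continuous_map_from_subtopology)
  have "homotopic_with (\<lambda>h. True) (orbit_preimage M P A) (orbit_preimage M P A) id (id \<circ> (\<lambda>c. H (1, c)))"
    using cH H0 by (subst homotopic_with) (auto simp: tops intro!: exI[of _ H])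
  then show ?thesis
    using torsion_homology_dominated[OF tors f g] homotopic_with_sym by blast
qed

text \<open>The minimal face of a vertex is the vertex itself, and there the normals span
  everything, so the whole torus is collapsed.\<close>

lemma orbit_preimage_vertex:
  assumes v: "v extreme_point_of P"
  obtains c where "topspace (orbit_preimage M P {v}) = {c}"
proof -
  have vP: "v \<in> P" using v by (simp add: extreme_point_of_def)
  have "{v} face_of P" using v by (simp add: face_of_singleton)
  then have "mface v = {v}"
    using mface_unique[of "{v}" v] vP by simp
  then have "span N \<subseteq> stab v"
    using span_normal_sublattice_vertex[OF v] dual_0 unfolding stab_def by force
  then have "proj (v, cls u) = proj (v, cls 0)" if "u \<in> span N" for u
    using that vP by (subst proj_eq_iff) (auto simp: span_zero span_neg)
  then have "fib {v} = {proj (v, cls 0)}"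
    using vP span_zero by (subst fib_eq) (auto intro!: image_eqI)
  then show ?thesis
    using that by (simp add: topspace_orbit_preimage)
qed

end

subsection \<open>Conic sequences\<close>

lemma continuous_on_Max_family:
  fixes f :: "'i \<Rightarrow> 'b::topological_space \<Rightarrow> real"
  assumes "finite J" "J \<noteq> {}" "\<And>j. j \<in> J \<Longrightarrow> continuous_on S (f j)"
  shows "continuous_on S (\<lambda>x. Max ((\<lambda>j. f j x) ` J))"
  using assms
proof (induction J rule: finite_ne_induct)
  case (insert j J)
  then have "continuous_on S (\<lambda>x. max (f j x) (Max ((\<lambda>j. f j x) ` J)))"
    by (intro continuous_on_max) auto
  then show ?case
    using insert.hyps by simp
qed simp

text \<open>Here \<open>1 / g p\<close> is the largest factor by which \<open>p\<close> can be moved away from \<open>v\<close> inside \<open>E\<close>.\<close>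

lemma radial_projection:
  fixes E :: "'a::euclidean_space set"
  assumes E: "polytope E" and v: "v \<in> E"
  obtains g where "continuous_on UNIV g"
    "\<And>p. p \<in> E \<Longrightarrow> p \<noteq> v \<Longrightarrow> 0 < g p \<and> g p \<le> 1 \<and> (\<exists>F. F face_of E \<and> v \<notin> F \<and> v + (1 / g p) *\<^sub>R (p - v) \<in> F)"
proof -
  obtain H where H: "finite H" "E = \<Inter>H" "\<forall>h\<in>H. \<exists>a b. a \<noteq> 0 \<and> h = {x. a \<bullet> x \<le> b}"
    using polytope_imp_polyhedron[OF E] unfolding polyhedron_def by blast
  obtain a b where ab: "\<And>h. h \<in> H \<Longrightarrow> h = {x. a h \<bullet> x \<le> b h}"
    using H(3) by metis
  have E_iff: "x \<in> E \<longleftrightarrow> (\<forall>h\<in>H. a h \<bullet> x \<le> b h)" for x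
    using H(2) ab by blast
  \<comment> \<open>Only halfspaces in which \<open>v\<close> has slack can be left by moving away
    from \<open>v\<close>.\<close>
  define J where "J = {h \<in> H. a h \<bullet> v < b h}"
  have J: "finite J" using H(1) by (simp add: J_def)
  have tight: "a h \<bullet> (p - v) \<le> 0" if "h \<in> H" "h \<notin> J" "p \<in> E" for h p
  proof -
    have "a h \<bullet> p \<le> b h" "\<not> a h \<bullet> v < b h"
      using that by (auto simp: E_iff J_def)
    then show ?thesis by (simp add: inner_diff_right)
  qed
  \<comment> \<open>Otherwise the whole ray from \<open>v\<close> through \<open>p\<close> would lie
    in the bounded set \<open>E\<close>.\<close>
  have ray: "\<exists>h\<in>J. a h \<bullet> (p - v) > 0" if p: "p \<in> E" "p \<noteq> v" for p
  proof (rule ccontr)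
    assume "\<not> ?thesis"
    then have le: "a h \<bullet> (p - v) \<le> 0" if "h \<in> H" for h
      using tight[OF that _ p(1)] that by (cases "h \<in> J") force+
    obtain R where R: "\<And>x. x \<in> E \<Longrightarrow> norm x \<le> R"
      using polytope_imp_bounded[OF E] by (auto simp: bounded_iff)
    define t where "t = (\<bar>R\<bar> + norm v + 1) / norm (p - v)"
    have npv: "norm (p - v) > 0" using p by simp
    have t: "t \<ge> 0" by (simp add: t_def)
    have "v + t *\<^sub>R (p - v) \<in> E"
      unfolding E_iff
    proof
      fix h assume h: "h \<in> H"
      have "t * (a h \<bullet> (p - v)) \<le> 0"
        using le[OF h] t by (simp add: mult_nonneg_nonpos)
      moreover have "a h \<bullet> v \<le> b h" using v h by (simp add: E_iff)
      ultimately show "a h \<bullet> (v + t *\<^sub>R (p - v)) \<le> b h"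
        by (simp add: inner_add_right)
    qed
    from R[OF this] have "norm (t *\<^sub>R (p - v)) \<le> \<bar>R\<bar> + norm v"
      using norm_triangle_ineq4[of "v + t *\<^sub>R (p - v)" v] by simp
    moreover have "norm (t *\<^sub>R (p - v)) = \<bar>R\<bar> + norm v + 1"
      using npv by (simp add: t_def)
    ultimately show False by simp
  qed
  show thesis
  proof (cases "J = {}")
    case True
    \<comment> \<open>By \<open>ray\<close>, \<open>E\<close> has no point besides \<open>v\<close>,
      so the constant 1 satisfies the condition vacuously.\<close>
    show thesis
      by (rule that[of "\<lambda>_. 1"]) (use ray True in \<open>auto intro: continuous_on_const\<close>)
  next
    case False
    \<comment> \<open>The point \<open>v + c (p - v)\<close> satisfies constraint \<open>h\<close>
      iff \<open>c * f h p <= 1\<close>. Taking the maximum of these values instead of the minimum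
      of their reciprocals keeps \<open>g\<close> continuous everywhere, even at
      \<open>v\<close>.\<close>
    define f where "f h p = a h \<bullet> (p - v) / (b h - a h \<bullet> v)" for h p
    define g where "g p = Max ((\<lambda>h. f h p) ` J)" for p
    have "continuous_on UNIV g"
      unfolding g_def
      by (rule continuous_on_Max_family[OF J False])
        (auto simp: f_def J_def intro!: continuous_intros)
    moreover have "0 < g p \<and> g p \<le> 1 \<and> (\<exists>F. F face_of E \<and> v \<notin> F \<and> v + (1 / g p) *\<^sub>R (p - v) \<in> F)"
      if p: "p \<in> E" "p \<noteq> v" for p
    proof -
      have le_g: "f h p \<le> g p" if "h \<in> J" for h
        unfolding g_def using J that by (intro Max_ge) auto
      have "g p \<in> (\<lambda>h. f h p) ` J"
        unfolding g_def using J False by (intro Max_in) auto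
      then obtain k where k: "k \<in> J" "g p = f k p" by blast
      obtain h where h: "h \<in> J" "a h \<bullet> (p - v) > 0" using ray[OF p] by blast
      then have "f h p > 0" by (simp add: f_def J_def)
      then have g0: "g p > 0" using le_g[OF h(1)] by simp
      have "a k \<bullet> p \<le> b k" using p(1) k(1) by (simp add: E_iff J_def)
      then have g1: "g p \<le> 1" using k by (simp add: f_def J_def inner_diff_right)
      let ?r = "v + (1 / g p) *\<^sub>R (p - v)"
      have r: "a h \<bullet> ?r = a h \<bullet> v + (a h \<bullet> (p - v)) / g p" for h
        by (simp add: inner_add_right)
      have "?r \<in> E"
        unfolding E_iff
      proof
        fix h assume h: "h \<in> H"
        show "a h \<bullet> ?r \<le> b h"
        proof (cases "h \<in> J")
          case True
          then have "a h \<bullet> (p - v) \<le> g p * (b h - a h \<bullet> v)"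
            using le_g[OF True] by (simp add: f_def J_def divide_le_eq)
          then have "(a h \<bullet> (p - v)) / g p \<le> b h - a h \<bullet> v"
            using g0 by (simp add: divide_le_eq mult.commute)
          then show ?thesis unfolding r by simp
        next
          case False
          have "(a h \<bullet> (p - v)) / g p \<le> 0"
            using tight[OF h False p(1)] g0 by (simp add: divide_le_0_iff)
          moreover have "a h \<bullet> v \<le> b h" using v h by (simp add: E_iff)
          ultimately show ?thesis unfolding r by simp
        qed
      qed
      moreover have "a k \<bullet> ?r = b k"
      proof -
        have "a k \<bullet> (p - v) = g p * (b k - a k \<bullet> v)"
          using k by (simp add: f_def J_def)
        then have "(a k \<bullet> (p - v)) / g p = b k - a k \<bullet> v"
          using g0 by simp
        then show ?thesis unfolding r by simp
      qed
      ultimately have "?r \<in> E \<inter> {x. a k \<bullet> x = b k}" by simp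
      moreover have "v \<notin> E \<inter> {x. a k \<bullet> x = b k}"
        using k(1) by (simp add: J_def)
      moreover have "E \<inter> {x. a k \<bullet> x = b k} face_of E"
        using k(1) by (intro face_of_Int_supporting_hyperplane_le polytope_imp_convex[OF E]) (simp add: E_iff J_def)
      ultimately show ?thesis
        using g0 g1 by blast
    qed
    ultimately show thesis
      by (rule that)
  qed
qed

text \<open>For \<open>c > 1\<close> the point \<open>p\<close> lies strictly between
  \<open>v\<close> and the extended point, so a face through \<open>p\<close> contains both
  ends.\<close>

lemma face_of_radial_extension:
  fixes v :: "'a::real_vector"
  assumes F: "F face_of P" "p \<in> F" and "v \<in> P" "p \<noteq> v" "1 \<le> c" "v + c *\<^sub>R (p - v) \<in> P"
  shows "v + c *\<^sub>R (p - v) \<in> F"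
proof (cases "c = 1")
  case True
  then show ?thesis using F by simp
next
  case False
  with \<open>1 \<le> c\<close> have c: "c > 1" by simp
  let ?x = "v + c *\<^sub>R (p - v)"
  have "p \<in> open_segment v ?x"
    unfolding in_segment
  proof (intro conjI exI)
    show "v \<noteq> ?x" using c \<open>p \<noteq> v\<close> by simp
    show "0 < 1 / c" "1 / c < 1" using c by simp_all
    show "p = (1 - 1 / c) *\<^sub>R v + (1 / c) *\<^sub>R ?x"
      using c by (simp add: scaleR_add_right scaleR_left_diff_distrib scaleR_right_diff_distrib)
  qed
  then show ?thesis
    using F \<open>v \<in> P\<close> assms(6) unfolding face_of_def by blast
qed

section \<open>Attaching the star of a cone vertex\<close>

context lattice_full_polytope
begin

lemma torsion_homology_conic_step:
  assumes K: "\<And>F. F \<in> K \<Longrightarrow> F face_of P"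
    and down: "\<And>F G. F \<in> K \<Longrightarrow> G face_of P \<Longrightarrow> G \<subseteq> F \<Longrightarrow> G \<in> K"
    and v: "{v} \<in> K" and E: "E \<in> K" "v \<in> E" and max: "\<And>F. F \<in> K \<Longrightarrow> v \<in> F \<Longrightarrow> F \<subseteq> E"
    and K': "K' = {F \<in> K. v \<notin> F}"
    and av: "a \<bullet> v < b" and sep: "\<And>x. x \<in> \<Union>K' \<Longrightarrow> x \<in> E \<Longrightarrow> b < a \<bullet> x"
    and "even d"
    and t1: "torsion_homology (Suc d) (orbit_preimage M P (\<Union>K'))"
    and t2: "torsion_homology d (orbit_preimage M P (E \<inter> {x. a \<bullet> x = b}))"
  shows "torsion_homology (Suc d) (orbit_preimage M P (\<Union>K))"
proof -
  define Q where "Q = \<Union>K"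
  define Q' where "Q' = \<Union>K'"
  define W where "W = E \<inter> {x. a \<bullet> x \<le> b}"
  have vP: "v extreme_point_of P" using K[OF v] by (simp add: face_of_singleton)
  have EP: "E face_of P" using K[OF E(1)] .
  have "E \<subseteq> P" using EP by (rule face_of_imp_subset)
  have "polytope E" using EP polytope_P face_of_polytope_polytope by blast
  then have convE: "convex E" and clE: "closed E"
    by (auto simp: polytope_imp_convex polytope_imp_closed)
  have "K \<subseteq> {F. F face_of P}" using K by blast
  then have "finite K"
    using finite_polytope_faces[OF polytope_P] by (rule finite_subset)
  moreover have "closed F" if "F \<in> K" for F
    using K[OF that] polytope_P face_of_polytope_polytope polytope_imp_closed by blast
  ultimately have clQ: "closed Q" and clQ': "closed Q'"
    unfolding Q_def Q'_def K' by (auto intro!: closed_Union)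
  have QP: "Q \<subseteq> P" using K face_of_imp_subset by (fastforce simp: Q_def)
  have Q_eq: "Q = E \<union> Q'"
    unfolding Q_def Q'_def K' using max E by blast
  have vQ': "v \<notin> Q'" by (auto simp: Q'_def K')
  have E_face: "F \<subseteq> Q'" if "F face_of E" "v \<notin> F" for F
    using that down[OF E(1), of F] face_of_trans[OF that(1) EP] face_of_imp_subset[OF that(1)]
    by (auto simp: Q'_def K')
  obtain g where g: "continuous_on UNIV g"
    "\<And>p. p \<in> E \<Longrightarrow> p \<noteq> v \<Longrightarrow> 0 < g p \<and> g p \<le> 1 \<and> (\<exists>F. F face_of E \<and> v \<notin> F \<and> v + (1 / g p) *\<^sub>R (p - v) \<in> F)"
    using radial_projection[OF \<open>polytope E\<close> E(2)] by blast
  have g0: "0 < g p" and g1: "g p \<le> 1" and proj_Q': "v + (1 / g p) *\<^sub>R (p - v) \<in> Q'"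
    and proj_E: "v + (1 / g p) *\<^sub>R (p - v) \<in> E" if "p \<in> E" "p \<noteq> v" for p
    using g(2)[OF that] E_face face_of_imp_subset by blast+
  \<comment> \<open>The point lies on the segment from \<open>v\<close> to the radial projection of
    \<open>p\<close>, at parameter \<open>c * g p\<close>.\<close>
  have scale_E: "v + c *\<^sub>R (p - v) \<in> E" if p: "p \<in> E" "p \<noteq> v" and c: "1 \<le> c" "c \<le> 1 / g p" for p c
  proof -
    have "c * g p \<le> 1" using c(2) g0[OF p] by (simp add: le_divide_eq)
    moreover have "0 \<le> c * g p" using c(1) g0[OF p] by simp
    ultimately have "(1 - c * g p) *\<^sub>R v + (c * g p) *\<^sub>R (v + (1 / g p) *\<^sub>R (p - v)) \<in> E"
      using convexD_alt[OF convE E(2) proj_E[OF p]] by blast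
    moreover have "(1 - c * g p) *\<^sub>R v + (c * g p) *\<^sub>R (v + (1 / g p) *\<^sub>R (p - v)) = v + c *\<^sub>R (p - v)"
      using g0[OF p] by (simp add: scaleR_add_right scaleR_left_diff_distrib)
    ultimately show ?thesis by simp
  qed
  have scale_face: "v + c *\<^sub>R (p - v) \<in> F"
    if "p \<in> E" "p \<noteq> v" "1 \<le> c" "c \<le> 1 / g p" "F face_of P" "p \<in> F" for p c F
    using face_of_radial_extension[OF that(5,6), of v c] that scale_E[OF that(1-4)] E(2) \<open>E \<subseteq> P\<close> by blast
  \<comment> \<open>Radial projection fixes \<open>E \<inter> Q'\<close>: a point strictly between
    \<open>v\<close> and its projection would force \<open>v\<close> into the face of
    \<open>K'\<close> through it. This makes the next homotopy, stationary on \<open>Q'\<close>,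
    well defined and continuous.\<close>
  have g_Q': "g p = 1" if p: "p \<in> E" "p \<in> Q'" for p
  proof (rule ccontr)
    assume "g p \<noteq> 1"
    obtain F where F: "F \<in> K" "v \<notin> F" "p \<in> F" using p(2) by (auto simp: Q'_def K')
    then have "p \<noteq> v" by blast
    have "g p < 1" using g1[OF p(1) \<open>p \<noteq> v\<close>] \<open>g p \<noteq> 1\<close> by simp
    let ?r = "v + (1 / g p) *\<^sub>R (p - v)"
    have gp: "g p > 0" using g0[OF p(1) \<open>p \<noteq> v\<close>] .
    have "p \<in> open_segment v ?r"
      unfolding in_segment
    proof (intro conjI exI)
      show "v \<noteq> ?r" using gp \<open>p \<noteq> v\<close> by simp
      show "0 < g p" "g p < 1" by fact+
      show "p = (1 - g p) *\<^sub>R v + g p *\<^sub>R ?r"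
        using gp by (simp add: scaleR_add_right scaleR_left_diff_distrib)
    qed
    then have "v \<in> F"
      using K[OF F(1)] F(3) E(2) proj_E[OF p(1) \<open>p \<noteq> v\<close>] \<open>E \<subseteq> P\<close> unfolding face_of_def by blast
    then show False using F(2) by blast
  qed
  have convex_between: "1 \<le> (1 - s) + s * c \<and> (1 - s) + s * c \<le> c" if "s \<in> {0..1}" "1 \<le> c" for s c :: real
  proof -
    have "0 \<le> s * (c - 1)" "0 \<le> (1 - s) * (c - 1)"
      using that by simp_all
    then show ?thesis by (simp add: algebra_simps)
  qed
  have cg: "continuous_on S (\<lambda>x. g (snd x))" for S :: "(real \<times> 'a) set"
    using continuous_on_compose2[OF g(1), of S snd] by (simp add: continuous_on_snd)
  have open_v: "openin (top_of_set P) (P - {v})"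
    by (simp add: openin_delete)
  have tU: "torsion_homology (Suc d) (orbit_preimage M P (Q - {v}))"
  proof -
    define h where "h x = (if snd x \<in> E then v + ((1 - fst x) + fst x * (1 / g (snd x))) *\<^sub>R (snd x - v) else snd x)"
      for x :: "real \<times> 'a"
    have hE: "h (s, p) = v + ((1 - s) + s * (1 / g p)) *\<^sub>R (p - v)" if "p \<in> E" for s p
      using that by (simp add: h_def)
    have hQ': "h (s, p) = p" if "p \<in> Q'" for s p
      using that g_Q'[of p] by (simp add: h_def)
    have c1: "1 \<le> (1 - s) + s * (1 / g p)" "(1 - s) + s * (1 / g p) \<le> 1 / g p"
      if "s \<in> {0..1}" "p \<in> E" "p \<noteq> v" for s p
      using convex_between[OF that(1), of "1 / g p"] g0[OF that(2,3)] g1[OF that(2,3)] by simp_all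
    show ?thesis
    proof (rule torsion_homology_face_retract[where C = Q and O' = "P - {v}" and A' = Q' and h = h])
      show "closedin (top_of_set P) Q" using clQ QP by (simp add: closed_subset)
      show "openin (top_of_set P) (P - {v})" by (rule open_v)
      show "Q - {v} = Q \<inter> (P - {v})" using QP by blast
      show "Q' \<subseteq> Q - {v}" using Q_eq vQ' by blast
      show "torsion_homology (Suc d) (orbit_preimage M P Q')" using t1 by (simp add: Q'_def)
      let ?S = "{0..1::real} \<times> (E - {v})" and ?T = "{0..1::real} \<times> Q'"
      have ST: "?S \<union> ?T = {0..1} \<times> (Q - {v})" using Q_eq vQ' by blast
      have "?S = (?S \<union> ?T) \<inter> ({0..1} \<times> E)" "?T = (?S \<union> ?T) \<inter> ({0..1} \<times> Q')" using vQ' by auto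
      then have cl: "closedin (top_of_set (?S \<union> ?T)) ?S" "closedin (top_of_set (?S \<union> ?T)) ?T"
        by (metis closed_Times closed_atLeastAtMost clE closedin_closed_Int)
          (metis \<open>?T = (?S \<union> ?T) \<inter> ({0..1} \<times> Q')\<close> closed_Times closed_atLeastAtMost clQ' closedin_closed_Int)
      have "continuous_on (?S \<union> ?T) h"
        unfolding h_def
      proof (rule continuous_on_cases_local[OF cl])
        show "continuous_on ?S (\<lambda>x. v + ((1 - fst x) + fst x * (1 / g (snd x))) *\<^sub>R (snd x - v))"
          by (intro continuous_intros cg) (use g0 in force)
        show "continuous_on ?T snd" by (intro continuous_intros)
        show "v + ((1 - fst x) + fst x * (1 / g (snd x))) *\<^sub>R (snd x - v) = snd x"
          if "x \<in> ?S \<and> snd x \<notin> E \<or> x \<in> ?T \<and> snd x \<in> E" for x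
          using that g_Q'[of "snd x"] by auto
      qed
      then show "continuous_on ({0..1} \<times> (Q - {v})) h" by (simp only: ST)
      show "h (0, p) = p" for p by (simp add: h_def)
      show "h (1, p) \<in> Q'" if "p \<in> Q - {v}" for p
        using that hE[of p 1] hQ'[of p 1] proj_Q'[of p] Q_eq by auto
      fix s :: real and p
      assume s: "s \<in> {0..1}" and p: "p \<in> Q - {v}"
      show "h (s, p) \<in> F" if F: "F face_of P" "p \<in> F" for F
      proof (cases "p \<in> E")
        case True
        then show ?thesis
          using scale_face[OF True _ c1[OF s True] F] p hE by auto
      next
        case False
        then show ?thesis using F by (simp add: h_def)
      qed
      show "h (s, p) \<in> Q - {v}"
      proof (cases "p \<in> E")
        case True
        have "p \<noteq> v" using p by simp
        have "h (s, p) \<in> E"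
          using scale_E[OF True \<open>p \<noteq> v\<close> c1[OF s True \<open>p \<noteq> v\<close>]] hE[OF True] by simp
        moreover have "h (s, p) \<noteq> v"
          using c1(1)[OF s True \<open>p \<noteq> v\<close>] hE[OF True, of s] \<open>p \<noteq> v\<close> by auto
        ultimately show ?thesis using Q_eq by blast
      next
        case False
        then show ?thesis using p by (simp add: h_def)
      qed
    qed
  qed
  have tUW: "torsion_homology d (orbit_preimage M P (W - {v}))"
  proof -
    \<comment> \<open>The factor at which the ray from \<open>v\<close> through \<open>p\<close>
      meets the hyperplane.\<close>
    define c where "c p = (b - a \<bullet> v) / (a \<bullet> (p - v))" for p
    define h where "h x = v + ((1 - fst x) + fst x * c (snd x)) *\<^sub>R (snd x - v)" for x :: "real \<times> 'a"
    \<comment> \<open>The radial projection of \<open>p\<close> lies in \<open>Q'\<close>, hence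
      beyond the hyperplane, so the ray crosses the hyperplane before it leaves
      \<open>E\<close>.\<close>
    have pos: "0 < a \<bullet> (p - v)" "c p \<le> 1 / g p" if p: "p \<in> E" "p \<noteq> v" for p
    proof -
      have "b < a \<bullet> (v + (1 / g p) *\<^sub>R (p - v))"
        using sep proj_Q'[OF p] proj_E[OF p] by (simp add: Q'_def)
      then have "b - a \<bullet> v < (a \<bullet> (p - v)) / g p"
        by (simp add: inner_add_right)
      then have *: "(b - a \<bullet> v) * g p < a \<bullet> (p - v)"
        using g0[OF p] by (simp add: less_divide_eq)
      moreover have "0 < (b - a \<bullet> v) * g p"
        using av g0[OF p] by simp
      ultimately show "0 < a \<bullet> (p - v)" by linarith
      with * show "c p \<le> 1 / g p"
        using g0[OF p] by (simp add: c_def divide_le_eq le_divide_eq field_simps)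
    qed
    have c1: "1 \<le> c p" if "p \<in> W - {v}" for p
      using pos(1)[of p] that by (simp add: c_def W_def le_divide_eq inner_diff_right)
    have k1: "1 \<le> (1 - s) + s * c p" "(1 - s) + s * c p \<le> c p" "(1 - s) + s * c p \<le> 1 / g p"
      if "s \<in> {0..1}" "p \<in> W - {v}" for s p
      using convex_between[OF that(1) c1[OF that(2)]] pos(2)[of p] that(2) by (auto simp: W_def)
    show ?thesis
    proof (rule torsion_homology_face_retract[where C = W and O' = "P - {v}" and A' = "E \<inter> {x. a \<bullet> x = b}" and h = h])
      have "closed W" unfolding W_def using clE closed_halfspace_le by (rule closed_Int)
      then show "closedin (top_of_set P) W" using \<open>E \<subseteq> P\<close> by (intro closed_subset) (auto simp: W_def)
      show "openin (top_of_set P) (P - {v})" by (rule open_v)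
      show "W - {v} = W \<inter> (P - {v})" using \<open>E \<subseteq> P\<close> by (auto simp: W_def)
      show "E \<inter> {x. a \<bullet> x = b} \<subseteq> W - {v}" using av by (auto simp: W_def)
      show "torsion_homology d (orbit_preimage M P (E \<inter> {x. a \<bullet> x = b}))" by (rule t2)
      have "a \<bullet> (snd x - v) \<noteq> 0" if "x \<in> {0..1} \<times> (W - {v})" for x :: "real \<times> 'a"
        using pos(1)[of "snd x"] that by (auto simp: W_def)
      then show "continuous_on ({0..1} \<times> (W - {v})) h"
        unfolding h_def c_def by (intro continuous_intros) auto
      show "h (0, p) = p" for p by (simp add: h_def)
      fix p
      assume p: "p \<in> W - {v}"
      then have pE: "p \<in> E" "p \<noteq> v" by (auto simp: W_def)
      have hE: "h (s, p) \<in> E" if s: "s \<in> {0..1}" for s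
        using scale_E[OF pE k1(1,3)[OF s p]] by (simp add: h_def)
      have ah: "a \<bullet> h (s, p) = a \<bullet> v + ((1 - s) + s * c p) * (a \<bullet> (p - v))" for s
        by (simp add: h_def inner_add_right)
      have cp: "c p * (a \<bullet> (p - v)) = b - a \<bullet> v"
        using pos(1)[OF pE] by (simp add: c_def)
      show "h (1, p) \<in> E \<inter> {x. a \<bullet> x = b}"
        using hE[of 1] ah[of 1] cp by simp
      fix s :: real
      assume s: "s \<in> {0..1}"
      show "h (s, p) \<in> F" if F: "F face_of P" "p \<in> F" for F
        using scale_face[OF pE k1(1,3)[OF s p] F] by (simp add: h_def)
      have "((1 - s) + s * c p) * (a \<bullet> (p - v)) \<le> c p * (a \<bullet> (p - v))"
        using k1(2)[OF s p] pos(1)[OF pE] by (intro mult_right_mono) auto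
      then have "a \<bullet> h (s, p) \<le> b" using ah[of s] cp by linarith
      moreover have "h (s, p) \<noteq> v"
        using k1(1)[OF s p] pE(2) by (auto simp: h_def)
      ultimately show "h (s, p) \<in> W - {v}"
        using hE[OF s] by (simp add: W_def)
    qed
  qed
  have tW: "torsion_homology (Suc d) (orbit_preimage M P W)"
  proof (rule torsion_homology_face_retract[where C = W and O' = P and A' = "{v}" and h = "\<lambda>x. (1 - fst x) *\<^sub>R snd x + fst x *\<^sub>R v"])
    have "closed W" unfolding W_def using clE closed_halfspace_le by (rule closed_Int)
    then show "closedin (top_of_set P) W" using \<open>E \<subseteq> P\<close> by (intro closed_subset) (auto simp: W_def)
    show "openin (top_of_set P) P" by simp
    show "W = W \<inter> P" using \<open>E \<subseteq> P\<close> by (auto simp: W_def)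
    have vW: "v \<in> W" using av E(2) by (simp add: W_def)
    then show "{v} \<subseteq> W" by simp
    obtain x where "topspace (orbit_preimage M P {v}) = {x}"
      using orbit_preimage_vertex[OF vP] by blast
    then show "torsion_homology (Suc d) (orbit_preimage M P {v})"
      using \<open>even d\<close> by (intro torsion_homology_singleton) auto
    show "continuous_on ({0..1} \<times> W) (\<lambda>x. (1 - fst x) *\<^sub>R snd x + fst x *\<^sub>R v)"
      by (intro continuous_intros)
    have "convex W" unfolding W_def using convE convex_halfspace_le by (rule convex_Int)
    then show "(1 - fst (s, p)) *\<^sub>R snd (s, p) + fst (s, p) *\<^sub>R v \<in> W" if "s \<in> {0..1}" "p \<in> W" for s p
      using convexD_alt[OF _ that(2) vW, of s] that(1) by simp
    show "(1 - fst (s, p)) *\<^sub>R snd (s, p) + fst (s, p) *\<^sub>R v \<in> F"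
      if s: "s \<in> {0..1}" and p: "p \<in> W" and F: "F face_of P" "p \<in> F" for s p F
    proof -
      \<comment> \<open>This makes moving towards \<open>v\<close> admissible: a face
        \<open>F\<close> through \<open>p\<close> that misses \<open>v\<close> would put
        \<open>F \<inter> E\<close> into \<open>K'\<close>, hence \<open>p\<close> strictly beyond
        the hyperplane.\<close>
      have "v \<in> F"
      proof (rule ccontr)
        assume "v \<notin> F"
        have "F \<inter> E face_of P" using F(1) EP by (rule face_of_Int)
        then have "F \<inter> E \<in> K'"
          using down[OF E(1), of "F \<inter> E"] \<open>v \<notin> F\<close> by (auto simp: K')
        then have "b < a \<bullet> p" using sep[of p] p F(2) by (auto simp: W_def)
        then show False using p by (simp add: W_def)
      qed
      then show ?thesis
        using convexD_alt[OF face_of_imp_convex[OF F(1)] F(2), of v s] s by simp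
    qed
  qed auto
  let ?X = "orbit_preimage M P Q"
  have sub: "subtopology ?X (fib A) = orbit_preimage M P A" if "A \<subseteq> Q" for A
  proof -
    have "fib Q \<inter> fib A = fib A" using that by (auto simp: fib_def)
    then show ?thesis by (simp add: orbit_preimage_eq subtopology_subtopology)
  qed
  have WQ: "W \<subseteq> Q" "W - {v} \<subseteq> Q" using Q_eq by (auto simp: W_def)
  have open_X: "openin ?X (fib (Q \<inter> A))" if "openin (top_of_set P) A" for A
  proof -
    have "fib (Q \<inter> A) = fib Q \<inter> fib A" by (auto simp: fib_def)
    then show ?thesis
      using openin_fib[OF that] by (simp add: orbit_preimage_eq openin_subtopology_Int2)
  qed
  \<comment> \<open>The hyperplane separates \<open>v\<close> from \<open>Q'\<close> only inside
    \<open>E\<close>, and other parts of \<open>Q'\<close> may lie below it. Removing the closed set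
    \<open>Q'\<close> keeps the second set open and places it inside \<open>W\<close>.\<close>
  have "torsion_homology (Suc d) ?X"
  proof (rule torsion_homology_Mayer_Vietoris[where U = "fib (Q \<inter> (P - {v}))"
        and V = "fib (Q \<inter> (P \<inter> ({x. a \<bullet> x < b} - Q')))" and W = "fib W"])
    show "openin ?X (fib (Q \<inter> (P - {v})))" by (rule open_X[OF open_v])
    have "open ({x. a \<bullet> x < b} - Q')" using clQ' by (intro open_Diff open_halfspace_lt)
    then show "openin ?X (fib (Q \<inter> (P \<inter> ({x. a \<bullet> x < b} - Q'))))"
      by (intro open_X openin_open_Int)
    show "topspace ?X \<subseteq> fib (Q \<inter> (P - {v})) \<union> fib (Q \<inter> (P \<inter> ({x. a \<bullet> x < b} - Q')))"
      using QP av vQ' by (auto simp: topspace_orbit_preimage fib_def)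
    show "fib (Q \<inter> (P \<inter> ({x. a \<bullet> x < b} - Q'))) \<subseteq> fib W"
      using Q_eq by (auto simp: fib_def W_def)
    have "Q \<inter> (P - {v}) = Q - {v}" using QP by blast
    then show "torsion_homology (Suc d) (subtopology ?X (fib (Q \<inter> (P - {v}))))"
      using tU sub[of "Q - {v}"] by auto
    show "torsion_homology (Suc d) (subtopology ?X (fib W))"
      using tW sub[OF WQ(1)] by simp
    have "fib (Q \<inter> (P - {v})) \<inter> fib W = fib (W - {v})"
      using Q_eq \<open>E \<subseteq> P\<close> by (auto simp: fib_def W_def)
    then show "torsion_homology d (subtopology ?X (fib (Q \<inter> (P - {v})) \<inter> fib W))"
      using tUW sub[OF WQ(2)] by simp
  qed
  then show ?thesis by (simp add: Q_def)
qed

section \<open>Unwinding a conic sequence\<close>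

lemma conic_sequenceD:
  assumes "conic_sequence P l K v E"
  shows "l = card {w. w extreme_point_of P}" "K l = {F. F face_of P}"
    "\<forall>i\<in>{2..l}. {v i} \<in> K i \<and>
        {G \<in> K i. v i \<in> G \<and> (\<forall>F\<in>K i. v i \<in> F \<longrightarrow> G \<subseteq> F \<longrightarrow> F = G)} = {E i} \<and>
        K (i - 1) = K i - {F \<in> K i. v i \<in> F \<and> F \<subseteq> E i}"
    "v 1 extreme_point_of P" "K 1 = {{}, {v 1}}"
  using assms[unfolded conic_sequence_def]
  by - ((elim conjE, assumption)+)

text \<open>In a finite complex every face through \<open>v i\<close> lies below a maximal one, so
  the unique maximal element is the greatest. The removed interval thus consists of all faces
  through \<open>v i\<close>.\<close>

lemma conic_sequence_step:
  assumes conic: "conic_sequence P l K v E" and i: "i \<in> {2..l}"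
    and fin: "finite (K i)"
  shows "{v i} \<in> K i" "E i \<in> K i" "v i \<in> E i" "\<And>F. F \<in> K i \<Longrightarrow> v i \<in> F \<Longrightarrow> F \<subseteq> E i"
    "K (i - 1) = {F \<in> K i. v i \<notin> F}"
proof -
  note steps = conic_sequenceD(3)[OF conic]
  have c: "{v i} \<in> K i"
    "{G \<in> K i. v i \<in> G \<and> (\<forall>F\<in>K i. v i \<in> F \<longrightarrow> G \<subseteq> F \<longrightarrow> F = G)} = {E i}"
    "K (i - 1) = K i - {F \<in> K i. v i \<in> F \<and> F \<subseteq> E i}"
    by (rule conjunct1[OF bspec[OF steps i]], rule conjunct1[OF conjunct2[OF bspec[OF steps i]]],
        rule conjunct2[OF conjunct2[OF bspec[OF steps i]]])
  show "{v i} \<in> K i" by (rule c)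
  show "E i \<in> K i" "v i \<in> E i" using c(2) by blast+
  show max: "F \<subseteq> E i" if F: "F \<in> K i" "v i \<in> F" for F
  proof -
    have "finite {G \<in> K i. v i \<in> G}" using fin by simp
    from finite_has_maximal2[OF this, of F] F
    obtain m where m: "m \<in> K i" "v i \<in> m" "F \<subseteq> m" "\<And>G. G \<in> K i \<Longrightarrow> v i \<in> G \<Longrightarrow> m \<subseteq> G \<Longrightarrow> m = G"
      by auto
    then have "m \<in> {G \<in> K i. v i \<in> G \<and> (\<forall>F\<in>K i. v i \<in> F \<longrightarrow> G \<subseteq> F \<longrightarrow> F = G)}"
      by blast
    then have "m = E i" using c(2) by blast
    then show ?thesis using m(3) by simp
  qed
  show "K (i - 1) = {F \<in> K i. v i \<notin> F}"
    using c(3) max by blast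
qed

text \<open>Downward induction from the full face complex: deleting all faces through a vertex
  preserves closure under subfaces.\<close>

lemma conic_sequence_subcomplex:
  assumes conic: "conic_sequence P l K v E" and i: "i \<in> {1..l}"
  shows "K i \<subseteq> {F. F face_of P} \<and> (\<forall>F\<in>K i. \<forall>G. G face_of P \<longrightarrow> G \<subseteq> F \<longrightarrow> G \<in> K i)"
  using i
proof (induction "l - i" arbitrary: i)
  case 0
  then have "i = l" by simp
  then have "K i = {F. F face_of P}"
    using conic_sequenceD(2)[OF conic] by simp
  then show ?case by simp
next
  case (Suc j)
  then have i: "Suc i \<in> {2..l}" and IH: "K (Suc i) \<subseteq> {F. F face_of P}"
    "\<forall>F\<in>K (Suc i). \<forall>G. G face_of P \<longrightarrow> G \<subseteq> F \<longrightarrow> G \<in> K (Suc i)"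
    using Suc.hyps(1)[of "Suc i"] by auto
  have "finite (K (Suc i))"
    using IH(1) finite_polytope_faces[OF polytope_P] by (rule finite_subset)
  from conic_sequence_step(5)[OF conic i this]
  have "K i = {F \<in> K (Suc i). v (Suc i) \<notin> F}" by simp
  then show ?case using IH by blast
qed

lemma torsion_homology_conic_sequence:
  assumes conic: "conic_sequence P l K v E"
    and fig: "\<And>i. i \<in> {2..l} \<Longrightarrow> conic_vertex_figure M K v E i (C i)"
    and triv: "\<And>i. i \<in> {2..l} \<Longrightarrow> trivial_group (reduced_cohomology_group (2 * k) (orbit_preimage M P (C i)))"
    and i: "i \<in> {1..l}"
  shows "torsion_homology (Suc (2 * k)) (orbit_preimage M P (\<Union>(K i)))"
  using i
proof (induction i)
  case (Suc i)
  show ?case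
  \<comment> \<open>Index 0 is outside the range; the true base is index 1, where the complex is a
    single vertex.\<close>
  proof (cases "i = 0")
    case True
    have v: "v 1 extreme_point_of P" "K 1 = {{}, {v 1}}"
      by (rule conic_sequenceD[OF conic])+
    obtain c where "topspace (orbit_preimage M P {v 1}) = {c}"
      using orbit_preimage_vertex[OF v(1)] by blast
    then have "torsion_homology (Suc (2 * k)) (orbit_preimage M P {v 1})"
      by (rule torsion_homology_singleton) simp
    then show ?thesis using v(2) True by simp
  next
    case False
    then have i: "Suc i \<in> {2..l}" "Suc i \<in> {1..l}" "i \<in> {1..l}" using Suc.prems by auto
    have cpx: "K (Suc i) \<subseteq> {F. F face_of P}"
      "\<forall>F\<in>K (Suc i). \<forall>G. G face_of P \<longrightarrow> G \<subseteq> F \<longrightarrow> G \<in> K (Suc i)"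
      using conic_sequence_subcomplex[OF conic i(2)] by blast+
    have fin: "finite (K (Suc i))"
      using cpx(1) finite_polytope_faces[OF polytope_P] by (rule finite_subset)
    note step = conic_sequence_step[OF conic i(1) fin]
    obtain a b where ab: "a \<bullet> v (Suc i) < b" "\<forall>x \<in> \<Union>(K i) \<inter> E (Suc i). b < a \<bullet> x"
      "C (Suc i) = E (Suc i) \<inter> {x. a \<bullet> x = b}"
      using fig[OF i(1)] unfolding conic_vertex_figure_def by auto
    show ?thesis
    proof (rule torsion_homology_conic_step[where v = "v (Suc i)" and E = "E (Suc i)" and K' = "K i" and a = a and b = b])
      show "torsion_homology (2 * k) (orbit_preimage M P (E (Suc i) \<inter> {x. a \<bullet> x = b}))"
        using torsion_homology_if_trivial_reduced[OF triv[OF i(1)]] ab(3) by simp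
      show "torsion_homology (Suc (2 * k)) (orbit_preimage M P (\<Union>(K i)))"
        using Suc.IH i(3) by blast
      show "K i = {F \<in> K (Suc i). v (Suc i) \<notin> F}"
        using step(5) by simp
      show "F face_of P" if "F \<in> K (Suc i)" for F
        using cpx(1) that by blast
      show "G \<in> K (Suc i)" if "F \<in> K (Suc i)" "G face_of P" "G \<subseteq> F" for F G
        using cpx(2) that by blast
      show "{v (Suc i)} \<in> K (Suc i)" "E (Suc i) \<in> K (Suc i)" "v (Suc i) \<in> E (Suc i)"
        by (rule step)+
      show "F \<subseteq> E (Suc i)" if "F \<in> K (Suc i)" "v (Suc i) \<in> F" for F
        using step(4)[OF that] .
      show "a \<bullet> v (Suc i) < b" by (rule ab)
      show "b < a \<bullet> x" if "x \<in> \<Union>(K i)" "x \<in> E (Suc i)" for x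
        using ab(2) that by blast
    qed simp
  qed
qed simp

end

theorem theorem4p1:
  fixes M P :: "'a::euclidean_space set" and n k l :: nat
    and K :: "nat \<Rightarrow> 'a set set" and v :: "nat \<Rightarrow> 'a" and E C :: "nat \<Rightarrow> 'a set"
  assumes "lattice_of_rank n M"
    and "lattice_polytope M P" and "aff_dim P = int n"
    and "conic_sequence P l K v E"
    and "\<And>i. i \<in> {2..l} \<Longrightarrow> conic_vertex_figure M K v E i (C i)"
    and "\<And>i. i \<in> {2..l} \<Longrightarrow>
           trivial_group (reduced_cohomology_group (2 * k) (orbit_preimage M P (C i)))"
  shows "trivial_group (cohomology_group (2 * k + 1) (toric_variety M P))"
proof -
  interpret lattice_full_polytope M P n
    by unfold_locales fact+
  have l: "l = card {w. w extreme_point_of P}" and Kl: "K l = {F. F face_of P}"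
    and v1: "v 1 extreme_point_of P"
    by (rule conic_sequenceD[OF assms(4)])+
  have "finite {w. w extreme_point_of P}"
    using polyhedron_P by (rule finite_polyhedron_extreme_points)
  \<comment> \<open>The extreme point \<open>v 1\<close> shows that \<open>l\<close> is at least
    1.\<close>
  then have "l \<in> {1..l}"
    using l v1 by (auto simp: Suc_le_eq card_gt_0_iff)
  from torsion_homology_conic_sequence[OF assms(4-6) this]
  have "torsion_homology (Suc (2 * k)) (orbit_preimage M P (\<Union>(K l)))" .
  also have "\<Union>(K l) = P"
    unfolding Kl using face_of_imp_subset face_of_refl[OF convex_P] by blast
  also have "orbit_preimage M P P = toric_variety M P"
  proof -
    have "fib P = topspace (toric_variety M P)"
      using orbit_map_in by (auto simp: fib_def)
    then show ?thesis by (simp add: orbit_preimage_eq)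
  qed
  finally show ?thesis
    using trivial_cohomology_group_if_torsion by simp
qed

end
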